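(* Let $X$ and $Y$ be Banach spaces such that either $X$ or $Y^*$ admits an unconditional finite-dimensional expansion of the identity. If $X\widehat{\otimes}_\pi Y$ contains no complemented subspace isomorphic to $\ell_1$, then $\mathcal{L}(X,Y^* )=\mathcal{K}(X,Y^* )$.
   Context: All Banach spaces are real; subspaces are norm closed linear subspaces. $X\widehat{\otimes}_\pi Y$ denotes the projective tensor product of $X$ and $Y$. $\mathcal{L}(X,Y^* )$ is the space of all continuous linear maps from $X$ to the dual $Y^*$, and $\mathcal{K}(X,Y^* )$ is its subspace of compact operators. $\mathcal{L}(Z)$ is the space of all continuous linear maps from $Z$ to itself. An unconditional expansion of the identity of a Banach space $Z$ is a sequence $(P_n)_{n\in\mathbb{N}}$ in $\mathcal{L}(Z)$ such that for each $z\in Z$ we have $z=\sum_{n\in\mathbb{N}}P_n(z)$, the series being unconditionally convergent in $Z$. It is called an unconditional finite-dimensional expansion of the identity if, moreover, every $P_n$ has finite rank. *)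

theory Defs
  imports "HOL-Analysis.Analysis"
begin

section \<open>The algebraic tensor product\<close>

text \<open>
  A list \<open>[(x\<^sub>1,y\<^sub>1),\<dots>,(x\<^sub>m,y\<^sub>m)]\<close> stands for the formal sum of the elementary tensors of its
  entries. Two formal sums denote the same tensor iff all bilinear forms agree on them. The bilinear
  forms are not required to be bounded.
\<close>

definition form_sum :: "('a \<Rightarrow> 'b \<Rightarrow> real) \<Rightarrow> ('a \<times> 'b) list \<Rightarrow> real" where
  "form_sum B xs = (\<Sum>(x, y)\<leftarrow>xs. B x y)"

definition tensor_eq :: "('a::real_vector \<times> 'b::real_vector) list \<Rightarrow> ('a \<times> 'b) list \<Rightarrow> bool" where
  "tensor_eq xs ys \<longleftrightarrow> (\<forall>B. bilinear B \<longrightarrow> form_sum B xs = form_sum B ys)"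

quotient_type (overloaded) ('a, 'b) tensor =
    "('a::real_vector \<times> 'b::real_vector) list" / tensor_eq
  morphisms rep_tensor tensor_of
  by (rule equivpI) (auto simp: reflp_def symp_def transp_def tensor_eq_def)

lemma form_sum_append [simp]: "form_sum B (xs @ ys) = form_sum B xs + form_sum B ys"
  by (simp add: form_sum_def)

lemma form_sum_Nil [simp]: "form_sum B [] = 0"
  by (simp add: form_sum_def)

lemma form_sum_Cons [simp]: "form_sum B ((x, y) # xs) = B x y + form_sum B xs"
  by (simp add: form_sum_def)

lemma form_sum_scale:
  "bilinear B \<Longrightarrow> form_sum B (map (\<lambda>(x, y). (c *\<^sub>R x, y)) xs) = c * form_sum B xs"
  by (induction xs) (auto simp: bilinear_lmul algebra_simps)

lemma form_sum_neg:
  "bilinear B \<Longrightarrow> form_sum B (map (\<lambda>(x, y). (- x, y)) xs) = - form_sum B xs"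
  using form_sum_scale[of B "-1" xs] by simp

instantiation tensor :: (real_vector, real_vector) real_vector
begin

lift_definition zero_tensor :: "('a, 'b) tensor" is "[]" .

lift_definition plus_tensor :: "('a, 'b) tensor \<Rightarrow> ('a, 'b) tensor \<Rightarrow> ('a, 'b) tensor" is "(@)"
  by (auto simp: tensor_eq_def)

lift_definition scaleR_tensor :: "real \<Rightarrow> ('a, 'b) tensor \<Rightarrow> ('a, 'b) tensor"
  is "\<lambda>c. map (\<lambda>(x, y). (c *\<^sub>R x, y))"
  by (auto simp: tensor_eq_def form_sum_scale)

definition uminus_tensor :: "('a, 'b) tensor \<Rightarrow> ('a, 'b) tensor" where
  "uminus_tensor u = (-1) *\<^sub>R u"

definition minus_tensor :: "('a, 'b) tensor \<Rightarrow> ('a, 'b) tensor \<Rightarrow> ('a, 'b) tensor" where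
  "minus_tensor u v = u + (-1) *\<^sub>R v"

instance
proof
  fix u v w :: "('a, 'b) tensor" and c d :: real
  show "u + v + w = u + (v + w)" by transfer (simp add: tensor_eq_def)
  show "u + v = v + u" by transfer (simp add: tensor_eq_def)
  show "0 + u = u" by transfer (simp add: tensor_eq_def)
  show "- u + u = 0" unfolding uminus_tensor_def
    by transfer (simp add: tensor_eq_def form_sum_neg)
  show "u - v = u + - v" by (simp add: minus_tensor_def uminus_tensor_def)
  show "c *\<^sub>R (u + v) = c *\<^sub>R u + c *\<^sub>R v" by transfer (simp add: tensor_eq_def)
  show "(c + d) *\<^sub>R u = c *\<^sub>R u + d *\<^sub>R u"
    by transfer (simp add: tensor_eq_def form_sum_scale distrib_right)
  show "c *\<^sub>R d *\<^sub>R u = (c * d) *\<^sub>R u"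
    by transfer (simp add: tensor_eq_def form_sum_scale del: map_map)
  show "1 *\<^sub>R u = u" by transfer (simp add: tensor_eq_def form_sum_scale)
qed

end

lifting_update tensor.lifting
lifting_forget tensor.lifting

section \<open>The projective norm\<close>

definition cost :: "('a::real_normed_vector \<times> 'b::real_normed_vector) list \<Rightarrow> real" where
  "cost xs = (\<Sum>(x, y)\<leftarrow>xs. norm x * norm y)"

definition proj_norm :: "('a::real_normed_vector, 'b::real_normed_vector) tensor \<Rightarrow> real" where
  "proj_norm u = Inf {cost xs | xs. tensor_of xs = u}"

lemma cost_nonneg: "0 \<le> cost xs"
  unfolding cost_def by (rule sum_list_nonneg) auto

lemma cost_append [simp]: "cost (xs @ ys) = cost xs + cost ys"
  by (simp add: cost_def)

lemma cost_scale: "cost (map (\<lambda>(x, y). (c *\<^sub>R x, y)) xs) = \<bar>c\<bar> * cost xs"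
  by (induction xs) (auto simp: cost_def algebra_simps)

lemma tensor_of_surj: "\<exists>xs. tensor_of xs = u"
  by (meson Quotient3_abs_rep Quotient3_tensor)

lemma proj_norm_nonneg: "0 \<le> proj_norm u"
  unfolding proj_norm_def using tensor_of_surj[of u]
  by (intro cInf_greatest) (auto simp: cost_nonneg)

lemma proj_norm_le: "tensor_of xs = u \<Longrightarrow> proj_norm u \<le> cost xs"
  unfolding proj_norm_def
  by (rule cInf_lower) (auto intro!: bdd_belowI[where m=0] simp: cost_nonneg)

lemma proj_norm_approx:
  assumes "e > 0"
  obtains xs where "tensor_of xs = u" "cost xs < proj_norm u + e"
proof -
  have "\<exists>r\<in>{cost xs | xs. tensor_of xs = u}. r < proj_norm u + e"
    using assms tensor_of_surj[of u] unfolding proj_norm_def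
    by (intro cInf_lessD) auto
  with that show thesis by blast
qed

lemma proj_norm_triangle: "proj_norm (u + v) \<le> proj_norm u + proj_norm v"
proof (rule field_le_epsilon)
  fix e :: real assume "e > 0"
  then have e: "e / 2 > 0" by simp
  obtain xs where xs: "tensor_of xs = u" "cost xs < proj_norm u + e / 2"
    by (rule proj_norm_approx[OF e])
  obtain ys where ys: "tensor_of ys = v" "cost ys < proj_norm v + e / 2"
    by (rule proj_norm_approx[OF e])
  have "tensor_of (xs @ ys) = u + v"
    using xs(1) ys(1) by (metis plus_tensor.abs_eq)
  from proj_norm_le[OF this] show "proj_norm (u + v) \<le> proj_norm u + proj_norm v + e"
    using xs(2) ys(2) by simp
qed

lemma proj_norm_0 [simp]: "proj_norm 0 = 0"
proof -
  have "proj_norm (0 :: ('a, 'b) tensor) \<le> cost ([] :: ('a \<times> 'b) list)"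
    by (rule proj_norm_le) (simp add: zero_tensor_def)
  then show ?thesis using proj_norm_nonneg[of "0 :: ('a, 'b) tensor"] by (simp add: cost_def)
qed

lemma proj_norm_scale_le: "proj_norm (c *\<^sub>R u) \<le> \<bar>c\<bar> * proj_norm u"
proof (rule field_le_epsilon)
  fix e :: real assume "e > 0"
  then have e: "e / (\<bar>c\<bar> + 1) > 0" by simp
  obtain xs where xs: "tensor_of xs = u" "cost xs < proj_norm u + e / (\<bar>c\<bar> + 1)"
    by (rule proj_norm_approx[OF e])
  have "tensor_of (map (\<lambda>(x, y). (c *\<^sub>R x, y)) xs) = c *\<^sub>R u"
    using xs(1) by (metis scaleR_tensor.abs_eq)
  from proj_norm_le[OF this] have "proj_norm (c *\<^sub>R u) \<le> \<bar>c\<bar> * cost xs"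
    by (simp add: cost_scale)
  also have "\<dots> \<le> \<bar>c\<bar> * (proj_norm u + e / (\<bar>c\<bar> + 1))"
    using xs(2) by (intro mult_left_mono) auto
  also have "\<dots> = \<bar>c\<bar> * proj_norm u + e * (\<bar>c\<bar> / (\<bar>c\<bar> + 1))"
    by (simp add: algebra_simps)
  also have "\<dots> \<le> \<bar>c\<bar> * proj_norm u + e * 1"
    using \<open>e > 0\<close> by (intro add_left_mono mult_left_mono) (auto simp: field_simps)
  finally show "proj_norm (c *\<^sub>R u) \<le> \<bar>c\<bar> * proj_norm u + e" by simp
qed

lemma proj_norm_scale: "proj_norm (c *\<^sub>R u) = \<bar>c\<bar> * proj_norm u"
proof (cases "c = 0")
  case False
  have "proj_norm u = proj_norm (inverse c *\<^sub>R c *\<^sub>R u)" using False by simp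
  also have "\<dots> \<le> \<bar>inverse c\<bar> * proj_norm (c *\<^sub>R u)" by (rule proj_norm_scale_le)
  finally have "\<bar>c\<bar> * proj_norm u \<le> proj_norm (c *\<^sub>R u)"
    using False by (simp add: field_simps)
  with proj_norm_scale_le[of c u] show ?thesis by simp
qed simp

lemma proj_norm_minus [simp]: "proj_norm (- u) = proj_norm u"
  using proj_norm_scale[of "-1" u] by simp

lemma proj_norm_minus_commute: "proj_norm (u - v) = proj_norm (v - u)"
  using proj_norm_minus[of "u - v"] by simp

lemma proj_norm_triangle_diff: "\<bar>proj_norm u - proj_norm v\<bar> \<le> proj_norm (u - v)"
  using proj_norm_triangle[of "u - v" v] proj_norm_triangle[of "v - u" u]
  by (simp add: proj_norm_minus_commute[of v u])

section \<open>The projective tensor product\<close>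

text \<open>
  The completion, built from Cauchy sequences of tensors modulo null sequences. That the projective
  norm vanishes only at \<open>0\<close> is not needed for the construction.
\<close>

definition proj_Cauchy :: "(nat \<Rightarrow> ('a::real_normed_vector, 'b::real_normed_vector) tensor) \<Rightarrow> bool" where
  "proj_Cauchy f \<longleftrightarrow> (\<forall>e>0. \<exists>N. \<forall>m\<ge>N. \<forall>n\<ge>N. proj_norm (f m - f n) < e)"

definition completion_eq ::
  "(nat \<Rightarrow> ('a::real_normed_vector, 'b::real_normed_vector) tensor) \<Rightarrow> (nat \<Rightarrow> ('a, 'b) tensor) \<Rightarrow> bool"
  where "completion_eq f g \<longleftrightarrow>
    proj_Cauchy f \<and> proj_Cauchy g \<and> (\<lambda>n. proj_norm (f n - g n)) \<longlonglongrightarrow> 0"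

lemma proj_Cauchy_const: "proj_Cauchy (\<lambda>n. u)"
  by (simp add: proj_Cauchy_def)

lemma proj_null_add:
  assumes "(\<lambda>n. proj_norm (f n)) \<longlonglongrightarrow> 0" "(\<lambda>n. proj_norm (g n)) \<longlonglongrightarrow> 0"
  shows "(\<lambda>n. proj_norm (f n + g n)) \<longlonglongrightarrow> 0"
proof (rule tendsto_sandwich[OF _ _ tendsto_const])
  show "\<forall>\<^sub>F n in sequentially. 0 \<le> proj_norm (f n + g n)"
    by (simp add: proj_norm_nonneg)
  show "\<forall>\<^sub>F n in sequentially. proj_norm (f n + g n) \<le> proj_norm (f n) + proj_norm (g n)"
    by (simp add: proj_norm_triangle)
  show "(\<lambda>n. proj_norm (f n) + proj_norm (g n)) \<longlonglongrightarrow> 0"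
    using tendsto_add[OF assms] by simp
qed

quotient_type (overloaded) ('a, 'b) proj_tensor =
    "nat \<Rightarrow> ('a::real_normed_vector, 'b::real_normed_vector) tensor" / partial: completion_eq
  morphisms rep_proj_tensor limit_of
proof (rule part_equivpI)
  show "\<exists>f::nat \<Rightarrow> ('a, 'b) tensor. completion_eq f f"
    by (rule exI[of _ "\<lambda>n. 0"]) (simp add: completion_eq_def proj_Cauchy_const)
  show "symp (completion_eq :: (nat \<Rightarrow> ('a, 'b) tensor) \<Rightarrow> _)"
    by (auto simp: symp_def completion_eq_def proj_norm_minus_commute)
  show "transp (completion_eq :: (nat \<Rightarrow> ('a, 'b) tensor) \<Rightarrow> _)"
  proof (rule transpI)
    fix f g h :: "nat \<Rightarrow> ('a, 'b) tensor"
    assume "completion_eq f g" "completion_eq g h"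
    then show "completion_eq f h"
      using proj_null_add[of "\<lambda>n. f n - g n" "\<lambda>n. g n - h n"] by (simp add: completion_eq_def)
  qed
qed

lemma proj_Cauchy_add:
  assumes "proj_Cauchy f" "proj_Cauchy g"
  shows "proj_Cauchy (\<lambda>n. f n + g n)"
  unfolding proj_Cauchy_def
proof (intro allI impI)
  fix e :: real assume "e > 0"
  then have "e / 2 > 0" by simp
  then obtain N M where N: "\<And>m n. m \<ge> N \<Longrightarrow> n \<ge> N \<Longrightarrow> proj_norm (f m - f n) < e / 2"
    and M: "\<And>m n. m \<ge> M \<Longrightarrow> n \<ge> M \<Longrightarrow> proj_norm (g m - g n) < e / 2"
    using assms unfolding proj_Cauchy_def by meson
  have "proj_norm (f m + g m - (f n + g n)) < e" if "m \<ge> max M N" "n \<ge> max M N" for m n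
  proof -
    have eq: "f m + g m - (f n + g n) = (f m - f n) + (g m - g n)" by simp
    show ?thesis
      unfolding eq
      using N[of m n] M[of m n] that proj_norm_triangle[of "f m - f n" "g m - g n"] by linarith
  qed
  then show "\<exists>N. \<forall>m\<ge>N. \<forall>n\<ge>N. proj_norm (f m + g m - (f n + g n)) < e" by blast
qed

lemma proj_Cauchy_scale:
  assumes "proj_Cauchy f"
  shows "proj_Cauchy (\<lambda>n. c *\<^sub>R f n)"
  unfolding proj_Cauchy_def
proof (intro allI impI)
  fix e :: real assume "e > 0"
  then have "e / (\<bar>c\<bar> + 1) > 0" by simp
  then obtain N where N: "\<And>m n. m \<ge> N \<Longrightarrow> n \<ge> N \<Longrightarrow> proj_norm (f m - f n) < e / (\<bar>c\<bar> + 1)"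
    using assms unfolding proj_Cauchy_def by meson
  have "proj_norm (c *\<^sub>R f m - c *\<^sub>R f n) < e" if "m \<ge> N" "n \<ge> N" for m n
  proof -
    have "proj_norm (c *\<^sub>R f m - c *\<^sub>R f n) = \<bar>c\<bar> * proj_norm (f m - f n)"
      by (simp add: proj_norm_scale flip: scaleR_diff_right)
    also have "\<dots> \<le> (\<bar>c\<bar> + 1) * proj_norm (f m - f n)"
      by (simp add: proj_norm_nonneg mult_right_mono)
    also have "\<dots> < e" using N[OF that] by (simp add: pos_less_divide_eq mult.commute)
    finally show ?thesis .
  qed
  then show "\<exists>N. \<forall>m\<ge>N. \<forall>n\<ge>N. proj_norm (c *\<^sub>R f m - c *\<^sub>R f n) < e" by blast
qed

lemma proj_norm_convergent:
  assumes "proj_Cauchy f"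
  shows "convergent (\<lambda>n. proj_norm (f n))"
proof -
  have "Cauchy (\<lambda>n. proj_norm (f n))"
  proof (rule CauchyI)
    fix e :: real assume "e > 0"
    then obtain N where "\<And>m n. m \<ge> N \<Longrightarrow> n \<ge> N \<Longrightarrow> proj_norm (f m - f n) < e"
      using assms unfolding proj_Cauchy_def by meson
    then show "\<exists>M. \<forall>m\<ge>M. \<forall>n\<ge>M. norm (proj_norm (f m) - proj_norm (f n)) < e"
      by (metis le_less_trans proj_norm_triangle_diff real_norm_def)
  qed
  then show ?thesis by (simp add: Cauchy_convergent_iff)
qed

lemma lim_proj_norm_cong:
  assumes "completion_eq f g"
  shows "lim (\<lambda>n. proj_norm (f n)) = lim (\<lambda>n. proj_norm (g n))"
proof -
  have f: "(\<lambda>n. proj_norm (f n)) \<longlonglongrightarrow> lim (\<lambda>n. proj_norm (f n))"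
    using assms by (intro convergent_LIMSEQ_iff[THEN iffD1] proj_norm_convergent)
      (simp add: completion_eq_def)
  have "(\<lambda>n. proj_norm (f n) - proj_norm (g n)) \<longlonglongrightarrow> 0"
    using assms unfolding completion_eq_def
    by (auto intro!: Lim_null_comparison[where g="\<lambda>n. proj_norm (f n - g n)"] simp: proj_norm_triangle_diff)
  from tendsto_diff[OF f this] have "(\<lambda>n. proj_norm (g n)) \<longlonglongrightarrow> lim (\<lambda>n. proj_norm (f n))" by simp
  then show ?thesis by (simp add: limI)
qed

instantiation proj_tensor :: (real_normed_vector, real_normed_vector) real_vector
begin

lift_definition zero_proj_tensor :: "('a, 'b) proj_tensor" is "\<lambda>n. 0"
  by (simp add: completion_eq_def proj_Cauchy_const)

lift_definition plus_proj_tensor ::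
    "('a, 'b) proj_tensor \<Rightarrow> ('a, 'b) proj_tensor \<Rightarrow> ('a, 'b) proj_tensor"
  is "\<lambda>f g n. f n + g n"
  subgoal for f f' g g'
    using proj_null_add[of "\<lambda>n. f n - f' n" "\<lambda>n. g n - g' n"]
    by (auto simp: completion_eq_def proj_Cauchy_add algebra_simps)
  done

lift_definition scaleR_proj_tensor :: "real \<Rightarrow> ('a, 'b) proj_tensor \<Rightarrow> ('a, 'b) proj_tensor"
  is "\<lambda>c f n. c *\<^sub>R f n"
  subgoal for c f f'
    using tendsto_mult_right_zero[of "\<lambda>n. proj_norm (f n - f' n)" sequentially "\<bar>c\<bar>"]
    by (auto simp: completion_eq_def proj_Cauchy_scale proj_norm_scale simp flip: scaleR_diff_right)
  done

definition uminus_proj_tensor :: "('a, 'b) proj_tensor \<Rightarrow> ('a, 'b) proj_tensor" where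
  "uminus_proj_tensor z = (-1) *\<^sub>R z"

definition minus_proj_tensor ::
    "('a, 'b) proj_tensor \<Rightarrow> ('a, 'b) proj_tensor \<Rightarrow> ('a, 'b) proj_tensor" where
  "minus_proj_tensor z w = z + (-1) *\<^sub>R w"

instance
proof
  fix u v w :: "('a, 'b) proj_tensor" and c d :: real
  show "u + v + w = u + (v + w)"
    by transfer (simp add: completion_eq_def proj_Cauchy_add add.assoc)
  show "u + v = v + u"
    by transfer (simp add: completion_eq_def proj_Cauchy_add add.commute)
  show "0 + u = u" by transfer (simp add: completion_eq_def)
  show "- u + u = 0" unfolding uminus_proj_tensor_def
    by transfer (simp add: completion_eq_def proj_Cauchy_const)
  show "u - v = u + - v" by (simp add: minus_proj_tensor_def uminus_proj_tensor_def)
  show "c *\<^sub>R (u + v) = c *\<^sub>R u + c *\<^sub>R v"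
    by transfer (simp add: completion_eq_def proj_Cauchy_add proj_Cauchy_scale scaleR_add_right)
  show "(c + d) *\<^sub>R u = c *\<^sub>R u + d *\<^sub>R u"
    by transfer (simp add: completion_eq_def proj_Cauchy_add proj_Cauchy_scale scaleR_add_left)
  show "c *\<^sub>R d *\<^sub>R u = (c * d) *\<^sub>R u"
    by transfer (simp add: completion_eq_def proj_Cauchy_scale)
  show "1 *\<^sub>R u = u" by transfer (simp add: completion_eq_def)
qed

end

instantiation proj_tensor :: (real_normed_vector, real_normed_vector) real_normed_vector
begin

lift_definition norm_proj_tensor :: "('a, 'b) proj_tensor \<Rightarrow> real"
  is "\<lambda>f. lim (\<lambda>n. proj_norm (f n))"
  by (rule lim_proj_norm_cong)

definition dist_proj_tensor :: "('a, 'b) proj_tensor \<Rightarrow> ('a, 'b) proj_tensor \<Rightarrow> real" where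
  "dist_proj_tensor z w = norm (z - w)"

definition sgn_proj_tensor :: "('a, 'b) proj_tensor \<Rightarrow> ('a, 'b) proj_tensor" where
  "sgn_proj_tensor z = z /\<^sub>R norm z"

definition uniformity_proj_tensor :: "(('a, 'b) proj_tensor \<times> ('a, 'b) proj_tensor) filter" where
  "uniformity_proj_tensor = (INF e\<in>{0<..}. principal {(x, y). dist x y < e})"

definition open_proj_tensor :: "('a, 'b) proj_tensor set \<Rightarrow> bool" where
  "open_proj_tensor U \<longleftrightarrow> (\<forall>x\<in>U. eventually (\<lambda>(x', y). x' = x \<longrightarrow> y \<in> U) uniformity)"

instance
proof
  fix u v :: "('a, 'b) proj_tensor" and c :: real
  have lim: "(\<lambda>n. proj_norm (f n)) \<longlonglongrightarrow> lim (\<lambda>n. proj_norm (f n))"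
    if "completion_eq f f" for f :: "nat \<Rightarrow> ('a, 'b) tensor"
    using that proj_norm_convergent by (simp add: completion_eq_def convergent_LIMSEQ_iff)
  show "(norm u = 0) = (u = 0)"
  proof transfer
    fix f :: "nat \<Rightarrow> ('a, 'b) tensor" assume f: "completion_eq f f"
    show "(lim (\<lambda>n. proj_norm (f n)) = 0) = completion_eq f (\<lambda>n. 0)"
      using lim[OF f] f by (auto simp: completion_eq_def proj_Cauchy_const intro: limI)
  qed
  show "norm (u + v) \<le> norm u + norm v"
  proof transfer
    fix f g :: "nat \<Rightarrow> ('a, 'b) tensor" assume f: "completion_eq f f" and g: "completion_eq g g"
    have "completion_eq (\<lambda>n. f n + g n) (\<lambda>n. f n + g n)"
      using f g by (simp add: completion_eq_def proj_Cauchy_add)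
    from lim[OF this] tendsto_add[OF lim[OF f] lim[OF g]]
    show "lim (\<lambda>n. proj_norm (f n + g n)) \<le> lim (\<lambda>n. proj_norm (f n)) + lim (\<lambda>n. proj_norm (g n))"
      by (rule LIMSEQ_le) (auto simp: proj_norm_triangle)
  qed
  show "norm (c *\<^sub>R u) = \<bar>c\<bar> * norm u"
  proof transfer
    fix c and f :: "nat \<Rightarrow> ('a, 'b) tensor" assume f: "completion_eq f f"
    show "lim (\<lambda>n. proj_norm (c *\<^sub>R f n)) = \<bar>c\<bar> * lim (\<lambda>n. proj_norm (f n))"
      using tendsto_mult[OF tendsto_const lim[OF f], of "\<bar>c\<bar>"]
      by (simp add: proj_norm_scale limI)
  qed
qed (auto simp: dist_proj_tensor_def sgn_proj_tensor_def uniformity_proj_tensor_def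
      open_proj_tensor_def)

end

text \<open>
  The canonical map of the algebraic tensor product: linear, isometric, and with dense range.
\<close>

lift_definition proj_embed ::
    "('a::real_normed_vector, 'b::real_normed_vector) tensor \<Rightarrow> ('a, 'b) proj_tensor"
  is "\<lambda>u n. u"
  by (simp add: completion_eq_def proj_Cauchy_const)

lemma linear_proj_embed: "linear proj_embed"
  by (rule linearI; transfer) (simp_all add: completion_eq_def proj_Cauchy_const)

lemma norm_proj_embed: "norm (proj_embed u) = proj_norm u"
  by transfer simp

lemma proj_embed_dense:
  assumes "e > 0"
  shows "\<exists>u. dist z (proj_embed u) < e"
  unfolding dist_norm minus_proj_tensor_def using assms
proof (transfer)
  fix e :: real and f :: "nat \<Rightarrow> ('a, 'b) tensor"
  assume e: "0 < e" and f: "completion_eq f f"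
  then have "e / 2 > 0" by simp
  then obtain N where N: "\<And>m n. m \<ge> N \<Longrightarrow> n \<ge> N \<Longrightarrow> proj_norm (f m - f n) < e / 2"
    using f unfolding completion_eq_def proj_Cauchy_def by meson
  have "proj_Cauchy (\<lambda>n. f n + (-1) *\<^sub>R f N)"
    using f by (intro proj_Cauchy_add proj_Cauchy_const) (simp add: completion_eq_def)
  then have "(\<lambda>n. proj_norm (f n + (-1) *\<^sub>R f N)) \<longlonglongrightarrow> lim (\<lambda>n. proj_norm (f n + (-1) *\<^sub>R f N))"
    by (simp only: proj_norm_convergent convergent_LIMSEQ_iff[symmetric])
  moreover have "\<forall>n\<ge>N. proj_norm (f n + (-1) *\<^sub>R f N) \<le> e / 2"
    using N[of _ N] by (auto intro: less_imp_le)
  ultimately have "lim (\<lambda>n. proj_norm (f n + (-1) *\<^sub>R f N)) \<le> e / 2"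
    by (intro LIMSEQ_le_const2) auto
  with e show "\<exists>u. lim (\<lambda>n. proj_norm (f n + (-1) *\<^sub>R u)) < e" by (intro exI[of _ "f N"]) auto
qed

lemma proj_embed_limit:
  assumes "proj_Cauchy f"
  shows "(\<lambda>n. proj_embed (f n)) \<longlonglongrightarrow> limit_of f"
proof (rule metric_LIMSEQ_I)
  fix e :: real assume "e > 0"
  then have e: "e / 2 > 0" by simp
  with assms obtain N where N: "\<And>m n. m \<ge> N \<Longrightarrow> n \<ge> N \<Longrightarrow> proj_norm (f m - f n) < e / 2"
    unfolding proj_Cauchy_def by meson
  have "dist (proj_embed (f k)) (limit_of f) < e" if k: "k \<ge> N" for k
  proof -
    have c: "proj_Cauchy (\<lambda>n. f k + (-1) *\<^sub>R f n)"
      using assms by (intro proj_Cauchy_add proj_Cauchy_const proj_Cauchy_scale)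
    have eqs: "completion_eq f f" "completion_eq (\<lambda>n. f k) (\<lambda>n. f k)"
        "completion_eq (\<lambda>n. (-1) *\<^sub>R f n) (\<lambda>n. (-1) *\<^sub>R f n)"
        "completion_eq (\<lambda>n. f k + (-1) *\<^sub>R f n) (\<lambda>n. f k + (-1) *\<^sub>R f n)"
      using assms c proj_Cauchy_scale[OF assms, of "-1"] proj_Cauchy_const[of "f k"]
      by (simp_all add: completion_eq_def)
    have "proj_embed (f k) - limit_of f = limit_of (\<lambda>n. f k + (-1) *\<^sub>R f n)"
      unfolding minus_proj_tensor_def
      by (simp only: proj_embed.abs_eq scaleR_proj_tensor.abs_eq[OF eqs(1)]
          plus_proj_tensor.abs_eq[OF eqs(2,3)])
    then have *: "dist (proj_embed (f k)) (limit_of f) = lim (\<lambda>n. proj_norm (f k + (-1) *\<^sub>R f n))"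
      by (simp only: dist_norm norm_proj_tensor.abs_eq[OF eqs(4)])
    have "(\<lambda>n. proj_norm (f k + (-1) *\<^sub>R f n)) \<longlonglongrightarrow> lim (\<lambda>n. proj_norm (f k + (-1) *\<^sub>R f n))"
      using c by (simp only: proj_norm_convergent convergent_LIMSEQ_iff[symmetric])
    moreover have "\<forall>n\<ge>N. proj_norm (f k + (-1) *\<^sub>R f n) \<le> e / 2"
      using N[OF k] by (auto intro: less_imp_le)
    ultimately have "lim (\<lambda>n. proj_norm (f k + (-1) *\<^sub>R f n)) \<le> e / 2"
      by (intro LIMSEQ_le_const2) auto
    with \<open>e > 0\<close> show ?thesis unfolding * by simp
  qed
  then show "\<exists>N. \<forall>n\<ge>N. dist (proj_embed (f n)) (limit_of f) < e" by blast
qed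

instance proj_tensor :: (real_normed_vector, real_normed_vector) banach
proof
  fix Z :: "nat \<Rightarrow> ('a, 'b) proj_tensor" assume Z: "Cauchy Z"
  have "\<forall>k. \<exists>u. dist (Z k) (proj_embed u) < inverse (real (Suc k))"
    by (intro allI proj_embed_dense) simp
  then obtain f where f: "\<And>k. dist (Z k) (proj_embed (f k)) < inverse (real (Suc k))" by metis
  have null: "(\<lambda>k. dist (Z k) (proj_embed (f k))) \<longlonglongrightarrow> 0"
    by (rule tendsto_sandwich[OF _ _ tendsto_const LIMSEQ_inverse_real_of_nat])
       (auto intro!: always_eventually less_imp_le[OF f] simp del: of_nat_Suc)
  have "proj_Cauchy f"
    unfolding proj_Cauchy_def
  proof (intro allI impI)
    fix e :: real assume "e > 0"
    then have e: "e / 3 > 0" by simp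
    from metric_CauchyD[OF Z e] obtain M
      where M: "\<And>m n. m \<ge> M \<Longrightarrow> n \<ge> M \<Longrightarrow> dist (Z m) (Z n) < e / 3" by blast
    from metric_LIMSEQ_D[OF null e] obtain N
      where N: "\<And>n. n \<ge> N \<Longrightarrow> dist (Z n) (proj_embed (f n)) < e / 3" by auto
    have "proj_norm (f m - f n) < e" if "m \<ge> max M N" "n \<ge> max M N" for m n
    proof -
      have "proj_norm (f m - f n) = dist (proj_embed (f m)) (proj_embed (f n))"
        by (simp add: dist_norm norm_proj_embed flip: linear_diff[OF linear_proj_embed])
      also have "\<dots> \<le> dist (Z m) (proj_embed (f m)) + dist (Z m) (Z n) + dist (Z n) (proj_embed (f n))"
        using dist_triangle[of "proj_embed (f m)" "proj_embed (f n)" "Z m"]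
          dist_triangle[of "Z m" "proj_embed (f n)" "Z n"]
        by (simp add: dist_commute)
      also have "\<dots> < e" using M[of m n] N[of m] N[of n] that by simp
      finally show ?thesis .
    qed
    then show "\<exists>N. \<forall>m\<ge>N. \<forall>n\<ge>N. proj_norm (f m - f n) < e" by blast
  qed
  have "Z \<longlonglongrightarrow> limit_of f"
    by (rule Lim_transform[OF proj_embed_limit[OF \<open>proj_Cauchy f\<close>]])
       (use null in \<open>simp add: dist_norm tendsto_norm_zero_iff\<close>)
  then show "convergent Z" by (rule convergentI)
qed

section \<open>The sequence space \<open>\<ell>\<^sub>1\<close>\<close>

typedef l1 = "{a :: nat \<Rightarrow> real. summable (\<lambda>n. \<bar>a n\<bar>)}"
  morphisms l1_nth l1_of
  by (rule exI[of _ "\<lambda>n. 0"]) simp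

setup_lifting type_definition_l1

instantiation l1 :: real_vector
begin

lift_definition zero_l1 :: l1 is "\<lambda>n. 0" by simp

lift_definition plus_l1 :: "l1 \<Rightarrow> l1 \<Rightarrow> l1" is "\<lambda>a b n. a n + b n"
  subgoal for a b
    by (rule summable_comparison_test'[where g="\<lambda>n. \<bar>a n\<bar> + \<bar>b n\<bar>"]) (auto intro: summable_add)
  done

lift_definition minus_l1 :: "l1 \<Rightarrow> l1 \<Rightarrow> l1" is "\<lambda>a b n. a n - b n"
  subgoal for a b
    by (rule summable_comparison_test'[where g="\<lambda>n. \<bar>a n\<bar> + \<bar>b n\<bar>"]) (auto intro: summable_add)
  done

lift_definition uminus_l1 :: "l1 \<Rightarrow> l1" is "\<lambda>a n. - a n" by simp

lift_definition scaleR_l1 :: "real \<Rightarrow> l1 \<Rightarrow> l1" is "\<lambda>c a n. c * a n"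
  by (simp add: abs_mult summable_mult)

instance
proof
  fix a b c :: l1 and r s :: real
  show "a + b + c = a + (b + c)" by transfer (simp add: add.assoc)
  show "a + b = b + a" by transfer (simp add: add.commute)
  show "0 + a = a" by transfer simp
  show "- a + a = 0" by transfer simp
  show "a - b = a + - b" by transfer simp
  show "r *\<^sub>R (a + b) = r *\<^sub>R a + r *\<^sub>R b" by transfer (simp add: distrib_left)
  show "(r + s) *\<^sub>R a = r *\<^sub>R a + s *\<^sub>R a" by transfer (simp add: distrib_right)
  show "r *\<^sub>R s *\<^sub>R a = (r * s) *\<^sub>R a" by transfer (simp add: mult.assoc)
  show "1 *\<^sub>R a = a" by transfer simp
qed

end

instantiation l1 :: real_normed_vector
begin

lift_definition norm_l1 :: "l1 \<Rightarrow> real" is "\<lambda>a. \<Sum>n. \<bar>a n\<bar>" .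

definition dist_l1 :: "l1 \<Rightarrow> l1 \<Rightarrow> real" where
  "dist_l1 a b = norm (a - b)"

definition sgn_l1 :: "l1 \<Rightarrow> l1" where
  "sgn_l1 a = a /\<^sub>R norm a"

definition uniformity_l1 :: "(l1 \<times> l1) filter" where
  "uniformity_l1 = (INF e\<in>{0<..}. principal {(x, y). dist x y < e})"

definition open_l1 :: "l1 set \<Rightarrow> bool" where
  "open_l1 U \<longleftrightarrow> (\<forall>x\<in>U. eventually (\<lambda>(x', y). x' = x \<longrightarrow> y \<in> U) uniformity)"

instance
proof
  fix a b :: l1 and r :: real
  show "(norm a = 0) = (a = 0)" by transfer (auto simp: suminf_eq_zero_iff)
  show "norm (a + b) \<le> norm a + norm b"
  proof transfer
    fix a b :: "nat \<Rightarrow> real" assume ab: "summable (\<lambda>n. \<bar>a n\<bar>)" "summable (\<lambda>n. \<bar>b n\<bar>)"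
    have s: "summable (\<lambda>n. \<bar>a n + b n\<bar>)"
      by (rule summable_comparison_test'[OF summable_add[OF ab]]) auto
    have "(\<Sum>n. \<bar>a n + b n\<bar>) \<le> (\<Sum>n. \<bar>a n\<bar> + \<bar>b n\<bar>)"
      by (rule suminf_le[OF _ s summable_add[OF ab]]) auto
    also have "\<dots> = (\<Sum>n. \<bar>a n\<bar>) + (\<Sum>n. \<bar>b n\<bar>)" by (rule suminf_add[OF ab, symmetric])
    finally show "(\<Sum>n. \<bar>a n + b n\<bar>) \<le> (\<Sum>n. \<bar>a n\<bar>) + (\<Sum>n. \<bar>b n\<bar>)" .
  qed
  show "norm (r *\<^sub>R a) = \<bar>r\<bar> * norm a" by transfer (simp add: abs_mult suminf_mult)
qed (auto simp: dist_l1_def sgn_l1_def uniformity_l1_def open_l1_def)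

end

section \<open>Operators, expansions of the identity, complemented subspaces\<close>

definition compact_operators :: "('a::real_normed_vector \<Rightarrow>\<^sub>L 'b::real_normed_vector) set" where
  "compact_operators = {T. compact (closure (blinfun_apply T ` cball 0 1))}"

definition finite_rank :: "('a::real_normed_vector \<Rightarrow>\<^sub>L 'b::real_normed_vector) \<Rightarrow> bool" where
  "finite_rank T \<longleftrightarrow> (\<exists>S. finite S \<and> range (blinfun_apply T) = span S)"

text \<open>
  Unconditional convergence of the series is convergence of the net of its finite partial sums,
  that is, summability in the sense of \<^const>\<open>HAS_SUM\<close>.
\<close>

definition unconditional_expansion :: "(nat \<Rightarrow> 'a::real_normed_vector \<Rightarrow>\<^sub>L 'a) \<Rightarrow> bool" where
  "unconditional_expansion P \<longleftrightarrow> (\<forall>z. ((\<lambda>n. blinfun_apply (P n) z) has_sum z) UNIV)"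

definition has_unconditional_fd_expansion :: "'a::real_normed_vector itself \<Rightarrow> bool" where
  "has_unconditional_fd_expansion _ \<longleftrightarrow>
    (\<exists>P :: nat \<Rightarrow> 'a \<Rightarrow>\<^sub>L 'a. unconditional_expansion P \<and> (\<forall>n. finite_rank (P n)))"

definition complemented_subspace :: "'a::real_normed_vector set \<Rightarrow> bool" where
  "complemented_subspace M \<longleftrightarrow> subspace M \<and> closed M \<and>
    (\<exists>Q :: 'a \<Rightarrow>\<^sub>L 'a. (\<forall>z. blinfun_apply Q (blinfun_apply Q z) = blinfun_apply Q z) \<and>
       range (blinfun_apply Q) = M)"

definition isomorphic_to_l1 :: "'a::real_normed_vector set \<Rightarrow> bool" where
  "isomorphic_to_l1 M \<longleftrightarrow> (\<exists>(f :: l1 \<Rightarrow> 'a) g. linear f \<and> homeomorphism UNIV M f g)"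

definition contains_complemented_l1 :: "'a::real_normed_vector itself \<Rightarrow> bool" where
  "contains_complemented_l1 _ \<longleftrightarrow>
    (\<exists>M :: 'a set. complemented_subspace M \<and> isomorphic_to_l1 M)"

end

theory Submission
  imports Defs
begin

text \<open>
  A bounded operator \<open>B\<close> from \<open>X\<close> to \<open>Y\<^sup>*\<close> is a bounded bilinear form on \<open>X \<times> Y\<close>, hence a bounded
  functional \<^term>\<open>proj_form B\<close> on the projective tensor product \<open>Z\<close>, with the same norm. An operator
  \<open>T\<close> that is not compact will be split into pieces whose functionals span a copy of \<open>c\<^sub>0\<close> in \<open>Z\<^sup>*\<close>;
  by an argument of Bessaga and Pelczynski this puts a complemented copy of \<open>\<ell>\<^sub>1\<close> into \<open>Z\<close>.

  If \<open>(P\<^sub>n)\<close> is an unconditional finite-dimensional expansion of the identity of \<open>X\<close> or of \<open>Y\<^sup>*\<close>, put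
  \<open>U\<^sub>n = T P\<^sub>n\<close> or \<open>U\<^sub>n = P\<^sub>n T\<close>. In either case the \<open>U\<^sub>n\<close> have finite rank and \<open>\<Sum> U\<^sub>n x\<close> converges
  unconditionally to \<open>T x\<close> for each \<open>x\<close>. If the partial sums were Cauchy in operator norm, \<open>T\<close> would be a
  norm limit of finite-rank operators and so compact. Otherwise there are \<open>d > 0\<close> and disjoint finite
  blocks \<open>G\<^sub>k\<close> such that \<open>S\<^sub>k = \<Sum>\<^bsub>n \<in> G\<^sub>k\<^esub> U\<^sub>n\<close> has norm above \<open>d\<close> (\<open>large_blocks_of_noncompact_sum\<close>,
  \<open>disjoint_blocks\<close>). By the uniform boundedness principle all finite sums of the \<open>U\<^sub>n\<close> are bounded by one
  constant; since every finite sum of the \<open>S\<^sub>k\<close> is such a sum, separating signs gives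
  \<open>\<Sum> \<bar>\<phi>\<^sub>k z\<bar> \<le> C \<parallel>z\<parallel>\<close> for the functionals \<open>\<phi>\<^sub>k\<close> of \<open>S\<^sub>k\<close>. As \<open>S\<^sub>k\<close> is large at some elementary tensor,
  there are \<open>w\<^sub>k\<close> in \<open>Z\<close> with \<open>\<phi>\<^sub>k w\<^sub>k = 1\<close> and \<open>\<parallel>w\<^sub>k\<parallel> \<le> 1/d\<close>.

  The map \<open>A z = (\<phi>\<^sub>k z)\<^sub>k\<close> is then bounded from \<open>Z\<close> to \<open>\<ell>\<^sub>1\<close>, and \<open>B a = \<Sum> a\<^sub>k w\<^sub>k\<close> is bounded from \<open>\<ell>\<^sub>1\<close> to \<open>Z\<close>.
  The matrix of \<open>A B\<close> has ones on its diagonal and summable columns. Rosenthal's lemma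
  (\<open>rosenthal_selection\<close>) passes to a subsequence along which the off-diagonal part of each column sums
  to at most \<open>1/2\<close>. Then \<open>A B\<close> is within \<open>1/2\<close> of the identity, hence has a left inverse \<open>E\<close>, and \<open>B E A\<close> is
  a projection of \<open>Z\<close> onto the isomorphic copy \<open>B \<ell>\<^sub>1\<close> of \<open>\<ell>\<^sub>1\<close>.
\<close>

section \<open>Extraction of a nearly diagonal submatrix\<close>

text \<open>
  Rosenthal's lemma. Cut the index set into infinitely many infinite rows. Either the submatrix on
  some row has small off-diagonal column sums, or each row \<open>p\<close> contains an index \<open>s p\<close> whose column
  picks up more than \<open>e\<close> from the rest of row \<open>p\<close>. The indices \<open>s p\<close> meet each row only once, so the
  submatrix on them avoids that mass and its column sums are bounded by \<open>C - e\<close>. Once the bound has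
  dropped to \<open>e\<close> or less, the first alternative must occur.
\<close>

lemma rosenthal_selection:
  fixes a :: "nat \<Rightarrow> nat \<Rightarrow> real"
  assumes e: "0 < e"
    and bound: "\<And>F j. finite F \<Longrightarrow> (\<Sum>i\<in>F. a i j) \<le> C"
  obtains s :: "nat \<Rightarrow> nat" where "inj s"
    "\<And>F j. finite F \<Longrightarrow> j \<notin> F \<Longrightarrow> (\<Sum>i\<in>F. a (s i) (s j)) \<le> e"
proof -
  have main: "\<exists>s::nat \<Rightarrow> nat. inj s \<and> (\<forall>F j. finite F \<longrightarrow> j \<notin> F \<longrightarrow> (\<Sum>i\<in>F. a (s i) (s j)) \<le> e)"
    if "\<And>F j. finite F \<Longrightarrow> (\<Sum>i\<in>F. a i j) \<le> real n * e" for n a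
    using that
  proof (induction n arbitrary: a)
    case 0
    have "(\<Sum>i\<in>F. a (id i) (id j)) \<le> e" if "finite F" for F j
      using "0.prems"[OF that, of j] e by simp
    then show ?case by (intro exI[of _ id]) auto
  next
    case (Suc n)
    \<comment> \<open>The element at position \<open>q\<close> of row \<open>p\<close>; the rows partition the natural numbers.\<close>
    define r where "r p q = prod_encode (p, q)" for p q
    have r_eq: "r p q = r p' q' \<longleftrightarrow> p = p' \<and> q = q'" for p q p' q'
      by (simp add: r_def)
    show ?case
    proof (cases "\<exists>p. \<forall>F j. finite F \<longrightarrow> j \<notin> F \<longrightarrow> (\<Sum>i\<in>F. a (r p i) (r p j)) \<le> e")
      case True
      then obtain p where "\<forall>F j. finite F \<longrightarrow> j \<notin> F \<longrightarrow> (\<Sum>i\<in>F. a (r p i) (r p j)) \<le> e"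
        by blast
      then show ?thesis by (intro exI[of _ "r p"]) (auto simp: inj_def r_eq)
    next
      case False
      then have "\<forall>p. \<exists>F j. finite F \<and> j \<notin> F \<and> e < (\<Sum>i\<in>F. a (r p i) (r p j))"
        by (meson not_le)
      then obtain G q where G: "\<And>p. finite (G p)" "\<And>p. q p \<notin> G p"
        "\<And>p. e < (\<Sum>i\<in>G p. a (r p i) (r p (q p)))"
        by metis
      define s where "s p = r p (q p)" for p
      have inj_s: "inj s" by (auto simp: inj_def s_def r_eq)
      have "(\<Sum>i\<in>F. a (s i) (s j)) \<le> real n * e" if F: "finite F" for F j
      proof -
        have disj: "s ` F \<inter> r j ` G j = {}"
          using G(2) by (auto simp: s_def r_eq)
        have "(\<Sum>i\<in>F. a (s i) (s j)) + (\<Sum>i\<in>G j. a (r j i) (s j))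
            = (\<Sum>i\<in>s ` F. a i (s j)) + (\<Sum>i\<in>r j ` G j. a i (s j))"
          by (subst (1 2) sum.reindex) (auto simp: inj_on_def s_def r_eq)
        also have "\<dots> = (\<Sum>i\<in>s ` F \<union> r j ` G j. a i (s j))"
          using F G(1) disj by (intro sum.union_disjoint[symmetric]) auto
        also have "\<dots> \<le> real (Suc n) * e"
          using F G(1) by (intro Suc.prems) auto
        finally show ?thesis
          using G(3)[of j] by (simp add: s_def algebra_simps)
      qed
      from Suc.IH[of "\<lambda>i j. a (s i) (s j)", OF this] obtain t :: "nat \<Rightarrow> nat"
        where t: "inj t" "\<forall>F j. finite F \<longrightarrow> j \<notin> F \<longrightarrow> (\<Sum>i\<in>F. a (s (t i)) (s (t j))) \<le> e"
        by blast
      have "inj (\<lambda>i. s (t i))" using inj_compose[OF inj_s t(1)] by (simp add: o_def)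
      with t(2) show ?thesis by (intro exI[of _ "\<lambda>i. s (t i)"]) simp
    qed
  qed
  obtain n where "C \<le> real n * e"
    using e by (metis ex_less_of_nat_mult less_imp_le)
  then have "(\<Sum>i\<in>F. a i j) \<le> real n * e" if "finite F" for F j
    using bound[OF that, of j] by simp
  with main[where a = a and n = n] obtain s :: "nat \<Rightarrow> nat"
    where "inj s" "\<forall>F j. finite F \<longrightarrow> j \<notin> F \<longrightarrow> (\<Sum>i\<in>F. a (s i) (s j)) \<le> e"
    by blast
  then show thesis by (intro that[of s]) auto
qed

section \<open>Completeness of \<open>\<ell>\<^sub>1\<close>\<close>

lemma summable_l1_nth: "summable (\<lambda>n. \<bar>l1_nth a n\<bar>)"
  using l1_nth[of a] by simp

lemma sum_l1_nth_le_norm: "finite F \<Longrightarrow> (\<Sum>i\<in>F. \<bar>l1_nth a i\<bar>) \<le> norm a"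
  unfolding norm_l1.rep_eq by (rule sum_le_suminf[OF summable_l1_nth]) auto

lemma norm_l1_le:
  assumes "\<And>m. (\<Sum>i<m. \<bar>l1_nth a i\<bar>) \<le> K"
  shows "norm a \<le> K"
  unfolding norm_l1.rep_eq using summable_l1_nth assms by (rule suminf_le_const)

text \<open>
  Bounded partial sums are the form in which absolute summability is met below; the inverse law of
  \<^term>\<open>l1_of\<close> holds only for summable sequences.
\<close>

lemma l1_nth_l1_of:
  assumes "\<And>m. (\<Sum>i<m. \<bar>f i\<bar>) \<le> K"
  shows "l1_nth (l1_of f) = f"
proof -
  have "summable (\<lambda>n. \<bar>f n\<bar>)"
    by (rule summableI_nonneg_bounded[OF _ assms]) auto
  then show ?thesis by (simp add: l1_of_inverse)
qed

lemma norm_l1_nth_le: "\<bar>l1_nth a i\<bar> \<le> norm a"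
  using sum_l1_nth_le_norm[of "{i}" a] by simp

text \<open>
  The limit is taken coordinatewise. The finite partial sums of the distance pass to the limit, and
  a bound on all of them shows both that the limit is summable and that the convergence is in norm.
\<close>

instance l1 :: banach
proof
  fix f :: "nat \<Rightarrow> l1" assume f: "Cauchy f"
  have "Cauchy (\<lambda>n. l1_nth (f n) i)" for i
  proof (rule metric_CauchyI)
    fix e :: real assume "e > 0"
    from metric_CauchyD[OF f this] obtain M where M: "\<forall>m\<ge>M. \<forall>n\<ge>M. dist (f m) (f n) < e" ..
    have "dist (l1_nth (f m) i) (l1_nth (f n) i) \<le> dist (f m) (f n)" for m n
      using norm_l1_nth_le[of "f m - f n" i] by (simp add: dist_norm minus_l1.rep_eq)
    with M show "\<exists>M. \<forall>m\<ge>M. \<forall>n\<ge>M. dist (l1_nth (f m) i) (l1_nth (f n) i) < e"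
      by (meson le_less_trans)
  qed
  then have "\<exists>l. (\<lambda>n. l1_nth (f n) i) \<longlonglongrightarrow> l" for i
    by (simp add: Cauchy_convergent convergentD)
  then obtain g where g: "\<And>i. (\<lambda>n. l1_nth (f n) i) \<longlonglongrightarrow> g i" by metis
  have partial: "(\<Sum>i<m. \<bar>l1_nth (f n) i - g i\<bar>) \<le> e"
    if "\<And>k. k \<ge> n \<Longrightarrow> norm (f n - f k) \<le> e" for n m e
  proof (rule LIMSEQ_le_const2)
    show "(\<lambda>k. \<Sum>i<m. \<bar>l1_nth (f n) i - l1_nth (f k) i\<bar>) \<longlonglongrightarrow> (\<Sum>i<m. \<bar>l1_nth (f n) i - g i\<bar>)"
      by (intro tendsto_intros g)
    show "\<exists>N. \<forall>k\<ge>N. (\<Sum>i<m. \<bar>l1_nth (f n) i - l1_nth (f k) i\<bar>) \<le> e"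
      using that sum_l1_nth_le_norm[of "{..<m}" "f n - f k" for k]
      by (metis (no_types, lifting) finite_lessThan minus_l1.rep_eq order_trans sum.cong)
  qed
  have close: "l1_nth (l1_of g) = g \<and> norm (f n - l1_of g) \<le> e"
    if n: "\<And>k. k \<ge> n \<Longrightarrow> norm (f n - f k) \<le> e" for n e
  proof -
    have "(\<Sum>i<m. \<bar>g i\<bar>) \<le> e + norm (f n)" for m
    proof -
      have "(\<Sum>i<m. \<bar>g i\<bar>) \<le> (\<Sum>i<m. \<bar>l1_nth (f n) i - g i\<bar> + \<bar>l1_nth (f n) i\<bar>)"
        by (rule sum_mono) linarith
      also have "\<dots> \<le> e + norm (f n)"
        unfolding sum.distrib using partial[OF n] by (intro add_mono sum_l1_nth_le_norm) auto
      finally show ?thesis .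
    qed
    then have g': "l1_nth (l1_of g) = g" by (rule l1_nth_l1_of)
    moreover have "norm (f n - l1_of g) \<le> e"
      using partial[OF n] by (intro norm_l1_le) (simp add: minus_l1.rep_eq g')
    ultimately show ?thesis by simp
  qed
  have "f \<longlonglongrightarrow> l1_of g"
  proof (rule metric_LIMSEQ_I)
    fix e :: real assume "e > 0"
    then have "e / 2 > 0" by simp
    from metric_CauchyD[OF f this] obtain M
      where M: "\<And>m n. m \<ge> M \<Longrightarrow> n \<ge> M \<Longrightarrow> dist (f m) (f n) < e / 2" by blast
    have "dist (f n) (l1_of g) < e" if "n \<ge> M" for n
    proof -
      have "norm (f n - f k) \<le> e / 2" if "k \<ge> n" for k
        using M[of n k] that \<open>n \<ge> M\<close> by (simp add: dist_norm)
      from close[OF this] \<open>e > 0\<close> show ?thesis by (simp add: dist_norm)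
    qed
    then show "\<exists>N. \<forall>n\<ge>N. dist (f n) (l1_of g) < e" by blast
  qed
  then show "convergent f" by (rule convergentI)
qed

section \<open>Complemented copies of \<open>\<ell>\<^sub>1\<close>\<close>

text \<open>
  Solving \<open>D x = b\<close> means finding a fixed point of \<open>x \<mapsto> b - (D x - x)\<close>, a contraction with constant
  \<open>1/2\<close>; the same estimate bounds the solution by \<open>2 \<parallel>b\<parallel>\<close>.
\<close>

lemma left_inverse_near_identity:
  fixes D :: "'a::banach \<Rightarrow>\<^sub>L 'a"
  assumes D: "\<And>x. norm (D x - x) \<le> norm x / 2"
  obtains E :: "'a \<Rightarrow>\<^sub>L 'a" where "\<And>x. E (D x) = x"
proof -
  have "\<exists>!x. D x = b" for b
  proof -
    have "\<exists>!x. b - (D x - x) = x"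
    proof (rule banach_fix_type[where c = "1/2"])
      show "\<forall>x y. dist (b - (D x - x)) (b - (D y - y)) \<le> 1/2 * dist x y"
      proof (intro allI)
        fix x y
        have "(b - (D x - x)) - (b - (D y - y)) = - (D (x - y) - (x - y))"
          by (simp add: blinfun.diff_right)
        then show "dist (b - (D x - x)) (b - (D y - y)) \<le> 1/2 * dist x y"
          using D[of "x - y"] by (simp only: dist_norm norm_minus_cancel)
      qed
    qed auto
    moreover have "b - (D x - x) = x \<longleftrightarrow> D x = b" for x
      by (auto simp: algebra_simps)
    ultimately show ?thesis by simp
  qed
  then obtain g where g: "\<And>b. D (g b) = b" and uniq: "\<And>x b. D x = b \<Longrightarrow> x = g b" by metis
  have "bounded_linear g"
  proof (rule bounded_linear_intro[where K = 2])
    show "g (x + y) = g x + g y" for x y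
      by (rule uniq[symmetric]) (simp add: blinfun.add_right g)
    show "g (c *\<^sub>R x) = c *\<^sub>R g x" for c x
      by (rule uniq[symmetric]) (simp add: blinfun.scaleR_right g)
    show "norm (g x) \<le> norm x * 2" for x
      using D[of "g x"] norm_triangle_ineq2[of "g x" x] by (simp add: g norm_minus_commute)
  qed
  then have "blinfun_apply (Blinfun g) = g" by (rule bounded_linear_Blinfun_apply)
  with uniq show thesis by (intro that[of "Blinfun g"]) metis
qed

text \<open>
  If \<open>R B\<close> is the identity, \<open>B R\<close> is a projection onto the range of \<open>B\<close>. That range is closed because
  it is the fixed-point set of the projection.
\<close>

lemma complemented_l1_of_left_inverse:
  fixes B :: "l1 \<Rightarrow>\<^sub>L 'z::real_normed_vector" and R :: "'z \<Rightarrow>\<^sub>L l1"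
  assumes RB: "\<And>a. R (B a) = a"
  shows "contains_complemented_l1 TYPE('z)"
proof -
  let ?Q = "B o\<^sub>L R"
  have range: "range B = {z. ?Q z = z}"
    using RB by (auto simp: image_iff) metis
  have "complemented_subspace (range B)"
    unfolding complemented_subspace_def
  proof (intro conjI exI[of _ ?Q] allI)
    show "subspace (range B)"
      by (intro subspace_UNIV linear_subspace_image bounded_linear.linear blinfun.bounded_linear_right)
    show "closed (range B)"
      unfolding range by (intro closed_Collect_eq continuous_intros)
    show "range ?Q = range B"
      using RB by (auto simp: image_iff) metis
  qed (simp add: RB)
  moreover have "isomorphic_to_l1 (range B)"
    unfolding isomorphic_to_l1_def
  proof (intro exI conjI)
    show "linear B" by (intro bounded_linear.linear blinfun.bounded_linear_right)
    show "homeomorphism UNIV (range B) B R"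
      unfolding homeomorphism_def by (auto simp: RB image_iff intro!: continuous_intros)
  qed
  ultimately show ?thesis unfolding contains_complemented_l1_def by blast
qed

lemma l1_synthesis:
  fixes w :: "nat \<Rightarrow> 'z::banach"
  assumes w: "\<And>j. norm (w j) \<le> K"
  shows "\<exists>B :: l1 \<Rightarrow>\<^sub>L 'z. \<forall>a. (\<lambda>j. l1_nth a j *\<^sub>R w j) sums B a"
proof -
  have le: "norm (l1_nth a j *\<^sub>R w j) \<le> \<bar>l1_nth a j\<bar> * K" for a j
    by (simp add: mult_left_mono w)
  have s_norm: "summable (\<lambda>j. norm (l1_nth a j *\<^sub>R w j))" for a
  proof (rule summable_comparison_test'[where N = 0])
    show "summable (\<lambda>j. \<bar>l1_nth a j\<bar> * K)"
      by (rule summable_mult2[OF summable_l1_nth])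
    show "norm (norm (l1_nth a j *\<^sub>R w j)) \<le> \<bar>l1_nth a j\<bar> * K" for j
      unfolding real_norm_def abs_norm_cancel by (rule le)
  qed
  define B where "B a = (\<Sum>j. l1_nth a j *\<^sub>R w j)" for a
  have sums: "(\<lambda>j. l1_nth a j *\<^sub>R w j) sums B a" for a
    unfolding B_def by (rule summable_sums[OF summable_norm_cancel[OF s_norm]])
  have "bounded_linear B"
  proof (rule bounded_linear_intro)
    show "B (a + b) = B a + B b" for a b
    proof (rule sums_unique2[OF sums])
      show "(\<lambda>j. l1_nth (a + b) j *\<^sub>R w j) sums (B a + B b)"
        using sums_add[OF sums[of a] sums[of b]] by (simp add: plus_l1.rep_eq scaleR_add_left)
    qed
    show "B (c *\<^sub>R a) = c *\<^sub>R B a" for c a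
    proof (rule sums_unique2[OF sums])
      show "(\<lambda>j. l1_nth (c *\<^sub>R a) j *\<^sub>R w j) sums (c *\<^sub>R B a)"
        using sums_scaleR_right[OF sums[of a], of c] by (simp add: scaleR_l1.rep_eq)
    qed
    show "norm (B a) \<le> norm a * K" for a
    proof -
      have "norm (B a) \<le> (\<Sum>j. norm (l1_nth a j *\<^sub>R w j))"
        unfolding B_def by (rule summable_norm[OF s_norm])
      also have "\<dots> \<le> (\<Sum>j. \<bar>l1_nth a j\<bar> * K)"
        by (rule suminf_le[OF le s_norm summable_mult2[OF summable_l1_nth]])
      also have "\<dots> = norm a * K"
        unfolding norm_l1.rep_eq by (rule suminf_mult2[OF summable_l1_nth, symmetric])
      finally show ?thesis .
    qed
  qed
  then have "blinfun_apply (Blinfun B) = B" by (rule bounded_linear_Blinfun_apply)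
  with sums show ?thesis by (intro exI[of _ "Blinfun B"]) simp
qed

lemma l1_analysis:
  fixes \<phi> :: "nat \<Rightarrow> 'z::real_normed_vector \<Rightarrow>\<^sub>L real"
  assumes \<phi>: "\<And>F z. finite F \<Longrightarrow> (\<Sum>i\<in>F. \<bar>\<phi> i z\<bar>) \<le> C * norm z"
  shows "\<exists>A :: 'z \<Rightarrow>\<^sub>L l1. \<forall>z. l1_nth (A z) = (\<lambda>i. \<phi> i z)"
proof -
  define A where "A z = l1_of (\<lambda>i. \<phi> i z)" for z
  have nth: "l1_nth (A z) = (\<lambda>i. \<phi> i z)" for z
    unfolding A_def by (rule l1_nth_l1_of) (rule \<phi>, simp)
  have "bounded_linear A"
  proof (rule bounded_linear_intro)
    show "A (x + y) = A x + A y" for x y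
      by (simp add: l1_nth_inject[symmetric] plus_l1.rep_eq nth blinfun.add_right)
    show "A (c *\<^sub>R x) = c *\<^sub>R A x" for c x
      by (simp add: l1_nth_inject[symmetric] scaleR_l1.rep_eq nth blinfun.scaleR_right)
    show "norm (A x) \<le> norm x * C" for x
      by (rule norm_l1_le) (use \<phi>[of "{..<m}" x for m] in \<open>simp add: nth mult.commute\<close>)
  qed
  then have "blinfun_apply (Blinfun A) = A" by (rule bounded_linear_Blinfun_apply)
  with nth show ?thesis by (intro exI[of _ "Blinfun A"]) simp
qed

text \<open>
  The synthesis operator \<open>B\<close> followed by the analysis operator \<open>A\<close> acts on \<open>\<ell>\<^sub>1\<close> by the matrix
  \<open>\<phi>\<^sub>i w\<^sub>j\<close>. The norm of an operator on \<open>\<ell>\<^sub>1\<close> is the supremum of the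
  \<open>\<ell>\<^sub>1\<close>-norms of its columns, so the hypothesis on the off-diagonal entries says that \<open>A B\<close> differs from the identity by at most \<open>1/2\<close>.
\<close>

lemma complemented_l1_of_almost_biorthogonal:
  fixes \<phi> :: "nat \<Rightarrow> 'z::banach \<Rightarrow>\<^sub>L real"
  assumes \<phi>: "\<And>F z. finite F \<Longrightarrow> (\<Sum>i\<in>F. \<bar>\<phi> i z\<bar>) \<le> C * norm z"
    and w: "\<And>j. norm (w j) \<le> K" and one: "\<And>j. \<phi> j (w j) = 1"
    and off: "\<And>F j. finite F \<Longrightarrow> j \<notin> F \<Longrightarrow> (\<Sum>i\<in>F. \<bar>\<phi> i (w j)\<bar>) \<le> 1/2"
  shows "contains_complemented_l1 TYPE('z)"
proof -
  obtain A :: "'z \<Rightarrow>\<^sub>L l1" where A: "\<And>z. l1_nth (A z) = (\<lambda>i. \<phi> i z)"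
    using l1_analysis[OF \<phi>] by blast
  obtain B :: "l1 \<Rightarrow>\<^sub>L 'z" where B: "\<And>a. (\<lambda>j. l1_nth a j *\<^sub>R w j) sums B a"
    using l1_synthesis[of w K, OF w] by blast
  have "norm ((A o\<^sub>L B) a - a) \<le> norm a / 2" for a
  proof (rule norm_l1_le)
    fix m
    \<comment> \<open>The matrix of \<open>A B\<close> minus the identity.\<close>
    define c where "c i j = \<phi> i (w j) - (if j = i then 1 else 0)" for i j
    have col: "(\<Sum>i<m. \<bar>c i j\<bar>) \<le> 1/2" for j
    proof -
      have "(\<Sum>i<m. \<bar>c i j\<bar>) = (\<Sum>i\<in>{..<m} - {j}. \<bar>c i j\<bar>)"
        by (rule sum.mono_neutral_right) (auto simp: c_def one)
      also have "\<dots> = (\<Sum>i\<in>{..<m} - {j}. \<bar>\<phi> i (w j)\<bar>)"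
        by (rule sum.cong) (auto simp: c_def)
      also have "\<dots> \<le> 1/2" by (rule off) auto
      finally show ?thesis .
    qed
    have entry: "\<bar>c i j\<bar> \<le> 1/2" if "i < m" for i j
      using member_le_sum[of i "{..<m}" "\<lambda>i. \<bar>c i j\<bar>"] col[of j] that by simp
    have s: "summable (\<lambda>j. \<bar>l1_nth a j * c i j\<bar>)" if "i < m" for i
    proof (rule summable_comparison_test'[where N = 0])
      show "summable (\<lambda>j. \<bar>l1_nth a j\<bar> * (1/2))"
        by (rule summable_mult2[OF summable_l1_nth])
      show "norm \<bar>l1_nth a j * c i j\<bar> \<le> \<bar>l1_nth a j\<bar> * (1/2)" for j
        unfolding real_norm_def abs_idempotent abs_mult using entry[OF that]
        by (intro mult_left_mono) auto
    qed
    have row: "\<bar>l1_nth ((A o\<^sub>L B) a - a) i\<bar> \<le> (\<Sum>j. \<bar>l1_nth a j * c i j\<bar>)" if "i < m" for i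
    proof -
      have "(\<lambda>j. l1_nth a j * \<phi> i (w j)) sums \<phi> i (B a)"
        using bounded_linear.sums[OF blinfun.bounded_linear_right B[of a], of "\<phi> i"]
        by (simp add: blinfun.scaleR_right)
      from sums_diff[OF this sums_single[of i "l1_nth a"]]
      have "(\<lambda>j. l1_nth a j * c i j) sums (\<phi> i (B a) - l1_nth a i)"
        by (rule sums_cong[THEN iffD1, rotated]) (auto simp: c_def algebra_simps)
      then have "l1_nth ((A o\<^sub>L B) a - a) i = (\<Sum>j. l1_nth a j * c i j)"
        by (simp add: minus_l1.rep_eq A sums_iff)
      then show ?thesis using summable_rabs[OF s[OF that]] by simp
    qed
    have "(\<Sum>i<m. \<bar>l1_nth ((A o\<^sub>L B) a - a) i\<bar>) \<le> (\<Sum>i<m. \<Sum>j. \<bar>l1_nth a j * c i j\<bar>)"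
      using row by (intro sum_mono) auto
    also have "\<dots> = (\<Sum>j. \<Sum>i<m. \<bar>l1_nth a j * c i j\<bar>)"
      using s by (intro suminf_sum[symmetric]) auto
    also have "\<dots> \<le> (\<Sum>j. \<bar>l1_nth a j\<bar> * (1/2))"
    proof (rule suminf_le)
      show "(\<Sum>i<m. \<bar>l1_nth a j * c i j\<bar>) \<le> \<bar>l1_nth a j\<bar> * (1/2)" for j
        using col[of j] by (simp add: abs_mult sum_distrib_left[symmetric] mult_left_mono
            del: divide_const_simps times_divide_eq_right)
      show "summable (\<lambda>j. \<Sum>i<m. \<bar>l1_nth a j * c i j\<bar>)"
        using s by (intro summable_sum) auto
    qed (rule summable_mult2[OF summable_l1_nth])
    also have "\<dots> = norm a / 2"
      unfolding norm_l1.rep_eq by (subst suminf_mult2[OF summable_l1_nth, symmetric]) simp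
    finally show "(\<Sum>i<m. \<bar>l1_nth ((A o\<^sub>L B) a - a) i\<bar>) \<le> norm a / 2" .
  qed
  then obtain E :: "l1 \<Rightarrow>\<^sub>L l1" where "\<And>a. E ((A o\<^sub>L B) a) = a"
    using left_inverse_near_identity[of "A o\<^sub>L B"] by blast
  then show ?thesis
    by (intro complemented_l1_of_left_inverse[of "E o\<^sub>L A" B]) simp
qed

text \<open>
  The first hypothesis says that the series \<open>\<Sum> \<phi>\<^sub>i\<close> is weakly unconditionally Cauchy in the dual.
  Boundedness of the \<open>w\<^sub>j\<close> turns it into a common bound for the columns of the matrix \<open>\<phi>\<^sub>i w\<^sub>j\<close>, so
  that Rosenthal's lemma reduces the claim to the almost biorthogonal case.
\<close>

lemma complemented_l1_of_wuc_functionals: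
  fixes \<phi> :: "nat \<Rightarrow> 'z::banach \<Rightarrow>\<^sub>L real"
  assumes \<phi>: "\<And>F z. finite F \<Longrightarrow> (\<Sum>i\<in>F. \<bar>\<phi> i z\<bar>) \<le> C * norm z"
    and w: "\<And>j. norm (w j) \<le> K" and one: "\<And>j. \<phi> j (w j) = 1"
  shows "contains_complemented_l1 TYPE('z)"
proof -
  have bound: "(\<Sum>i\<in>F. \<bar>\<phi> i (w j)\<bar>) \<le> \<bar>C\<bar> * K" if "finite F" for F j
  proof -
    have "(\<Sum>i\<in>F. \<bar>\<phi> i (w j)\<bar>) \<le> C * norm (w j)" by (rule \<phi>[OF that])
    also have "\<dots> \<le> \<bar>C\<bar> * K" using w by (intro mult_mono) auto
    finally show ?thesis .
  qed
  obtain s :: "nat \<Rightarrow> nat" where s: "inj s"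
    "\<And>F j. finite F \<Longrightarrow> j \<notin> F \<Longrightarrow> (\<Sum>i\<in>F. \<bar>\<phi> (s i) (w (s j))\<bar>) \<le> 1/2"
    by (rule rosenthal_selection[where a = "\<lambda>i j. \<bar>\<phi> i (w j)\<bar>" and e = "1/2" and C = "\<bar>C\<bar> * K"]) (use bound in auto)
  show ?thesis
  proof (rule complemented_l1_of_almost_biorthogonal[of "\<lambda>i. \<phi> (s i)" C "\<lambda>j. w (s j)" K])
    show "(\<Sum>i\<in>F. \<bar>\<phi> (s i) z\<bar>) \<le> C * norm z" if "finite F" for F z
      using \<phi>[of "s ` F" z] that s(1) by (simp add: sum.reindex inj_on_subset)
  qed (use w one s in auto)
qed

section \<open>Norm limits of finite-rank operators\<close>

text \<open>
  Bolzano-Weierstrass in a finite-dimensional subspace, by induction on a spanning set. By the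
  induction hypothesis the span of the smaller set is closed, so a new vector \<open>v\<close> has positive
  distance to it. This distance controls the coefficients of \<open>v\<close> along a bounded sequence; they
  converge along a subsequence, and the remaining parts stay bounded.
\<close>

lemma bounded_span_convergent_subseq:
  fixes u :: "nat \<Rightarrow> 'a::real_normed_vector"
  assumes "finite S" "\<And>n. u n \<in> span S" "\<And>n. norm (u n) \<le> K"
  shows "\<exists>l\<in>span S. \<exists>r. strict_mono r \<and> (u \<circ> r) \<longlonglongrightarrow> l"
  using assms
proof (induction S arbitrary: u K rule: finite_induct)
  case empty
  then have "u = (\<lambda>n. 0)" by auto
  then show ?case by (intro bexI[of _ 0] exI[of _ id]) (auto simp: strict_mono_def)
next
  case (insert v S)
  show ?case
  proof (cases "v \<in> span S")
    case True
    then have "span (insert v S) = span S" by (rule span_redundant)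
    with insert show ?thesis by metis
  next
    case False
    have "closed (span S)"
      unfolding closed_sequential_limits
    proof (intro allI impI, elim conjE)
      fix x l assume x: "\<forall>n. x n \<in> span S" and l: "x \<longlonglongrightarrow> l"
      from l obtain K where "\<And>n. norm (x n) \<le> K"
        using convergent_imp_Bseq[of x] by (auto simp: convergent_def Bseq_def)
      with insert.IH[of x K] x obtain l' r
        where "l' \<in> span S" "strict_mono r" "(x \<circ> r) \<longlonglongrightarrow> l'" by blast
      with LIMSEQ_subseq_LIMSEQ[OF l, of r] show "l \<in> span S"
        using LIMSEQ_unique by blast
    qed
    then have d: "0 < infdist v (span S)"
      using False span_zero by (intro infdist_pos_not_in_closed) auto
    from insert.prems(1) obtain c where c: "\<And>n. u n - c n *\<^sub>R v \<in> span S"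
      by (simp add: span_breakdown_eq) metis
    have c_le: "\<bar>c n\<bar> \<le> K / infdist v (span S)" for n
    proof (cases "c n = 0")
      case True
      moreover have "0 \<le> K" using insert.prems(2)[of n] norm_ge_zero[of "u n"] by linarith
      ultimately show ?thesis using d by simp
    next
      case False
      have "(- inverse (c n)) *\<^sub>R (u n - c n *\<^sub>R v) \<in> span S"
        by (rule span_scale[OF c])
      then have "infdist v (span S) \<le> dist v ((- inverse (c n)) *\<^sub>R (u n - c n *\<^sub>R v))"
        by (rule infdist_le)
      also have "\<dots> = norm (inverse (c n) *\<^sub>R u n)"
        using False by (simp add: dist_norm algebra_simps)
      also have "\<dots> \<le> K / \<bar>c n\<bar>"
        using insert.prems(2)[of n] by (simp add: field_simps divide_right_mono)
      finally show ?thesis using False d by (simp add: field_simps)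
    qed
    then have "bounded (range c)" by (auto simp: bounded_iff)
    then obtain cl r where r: "strict_mono r" and cl: "(c \<circ> r) \<longlonglongrightarrow> cl"
      using bounded_imp_convergent_subsequence by blast
    have "norm (u (r n) - c (r n) *\<^sub>R v) \<le> K + K / infdist v (span S) * norm v" for n
      using norm_triangle_ineq4[of "u (r n)" "c (r n) *\<^sub>R v"] insert.prems(2)[of "r n"]
        mult_right_mono[OF c_le[of "r n"] norm_ge_zero[of v]] by simp
    from insert.IH[of "\<lambda>n. u (r n) - c (r n) *\<^sub>R v", OF c this] obtain l r'
      where l: "l \<in> span S" and r': "strict_mono r'"
        and lim: "((\<lambda>n. u (r n) - c (r n) *\<^sub>R v) \<circ> r') \<longlonglongrightarrow> l" by blast
    have "(\<lambda>n. c (r (r' n))) \<longlonglongrightarrow> cl"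
      using LIMSEQ_subseq_LIMSEQ[OF cl r'] by (simp add: o_def)
    from tendsto_add[OF lim tendsto_scaleR[OF this tendsto_const[of v]]]
    have "(u \<circ> (r \<circ> r')) \<longlonglongrightarrow> l + cl *\<^sub>R v" by (simp add: o_def)
    moreover have "l + cl *\<^sub>R v \<in> span (insert v S)"
      using l by (auto simp: span_breakdown_eq intro: exI[of _ cl])
    ultimately show ?thesis using strict_mono_o[OF r r'] by blast
  qed
qed

lemma compact_span_cball:
  fixes S :: "'a::real_normed_vector set"
  assumes "finite S"
  shows "compact (span S \<inter> cball 0 K)"
  unfolding compact_def
proof (intro allI impI)
  fix f :: "nat \<Rightarrow> 'a" assume f: "\<forall>n. f n \<in> span S \<inter> cball 0 K"
  with bounded_span_convergent_subseq[OF assms, of f K] obtain l r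
    where l: "l \<in> span S" "strict_mono r" "(f \<circ> r) \<longlonglongrightarrow> l" by auto
  moreover have "l \<in> cball 0 K"
    unfolding mem_cball_0
    by (rule LIMSEQ_le_const2[OF tendsto_norm[OF l(3)]]) (use f in auto)
  ultimately show "\<exists>l\<in>span S \<inter> cball 0 K. \<exists>r. strict_mono r \<and> (f \<circ> r) \<longlonglongrightarrow> l" by blast
qed

lemma range_sum_finite_rank:
  fixes U :: "'i \<Rightarrow> 'a::real_normed_vector \<Rightarrow>\<^sub>L 'b::real_normed_vector"
  assumes "\<And>n. finite_rank (U n)" "finite F"
  obtains S where "finite S" "range (sum U F) \<subseteq> span S"
proof -
  from assms(1) obtain B where B: "\<And>n. finite (B n)" "\<And>n. range (U n) = span (B n)"
    unfolding finite_rank_def by metis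
  have "U n x \<in> span (\<Union>n\<in>F. B n)" if "n \<in> F" for n x
    using B(2)[of n] that span_mono[of "B n" "\<Union>n\<in>F. B n"] by blast
  then have "range (sum U F) \<subseteq> span (\<Union>n\<in>F. B n)"
    by (auto simp: blinfun.sum_left intro: span_sum)
  with B(1) assms(2) show thesis by (intro that[of "\<Union>n\<in>F. B n"]) auto
qed

text \<open>
  The unit ball is mapped by \<open>V\<close> into a compact set, and \<open>T\<close> stays within \<open>e / 4\<close> of \<open>V\<close> there, so a finite
  net for \<open>V\<close> is also one for \<open>T\<close>. In a complete space totally bounded closed sets are compact.
\<close>

lemma compact_operatorI_approx:
  fixes T :: "'a::real_normed_vector \<Rightarrow>\<^sub>L 'b::banach"
  assumes approx: "\<And>e. e > 0 \<Longrightarrow> \<exists>V S. finite S \<and> range (blinfun_apply V) \<subseteq> span S \<and> norm (T - V) \<le> e"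
  shows "T \<in> compact_operators"
proof -
  have "\<exists>k. finite k \<and> closure (T ` cball 0 1) \<subseteq> (\<Union>x\<in>k. ball x e)" if "e > 0" for e
  proof -
    from approx[of "e/4"] that obtain V :: "'a \<Rightarrow>\<^sub>L 'b" and S
      where S: "finite S" "range V \<subseteq> span S" and V: "norm (T - V) \<le> e/4" by auto
    from compact_span_cball[OF S(1), of "norm V"] that
    obtain k where k: "finite k" "span S \<inter> cball 0 (norm V) \<subseteq> (\<Union>x\<in>k. ball x (e/4))"
      unfolding compact_eq_totally_bounded by (meson divide_pos_pos zero_less_numeral)
    have "T ` cball 0 1 \<subseteq> (\<Union>x\<in>k. cball x (e/2))"
    proof clarify
      fix a :: 'a assume "a \<in> cball 0 1"
      then have a: "norm a \<le> 1" by simp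
      have "norm (V a) \<le> norm V * 1"
        by (rule order_trans[OF norm_blinfun]) (use a in \<open>intro mult_left_mono; simp\<close>)
      with S(2) k(2) obtain x where x: "x \<in> k" "dist x (V a) < e/4" by fastforce
      have "norm ((T - V) a) \<le> norm (T - V) * 1"
        by (rule order_trans[OF norm_blinfun]) (use a in \<open>intro mult_left_mono; simp\<close>)
      with V have "dist (V a) (T a) \<le> e/4"
        by (simp add: dist_norm blinfun.diff_left norm_minus_commute)
      with x(2) dist_triangle[of x "T a" "V a"] have "dist x (T a) \<le> e/2" by simp
      with x(1) show "T a \<in> (\<Union>x\<in>k. cball x (e/2))" by auto
    qed
    then have "closure (T ` cball 0 1) \<subseteq> (\<Union>x\<in>k. cball x (e/2))"
      using k(1) by (intro closure_minimal closed_UN) auto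
    also have "\<dots> \<subseteq> (\<Union>x\<in>k. ball x e)" using \<open>e > 0\<close> by fastforce
    finally show ?thesis using k(1) by blast
  qed
  then show ?thesis
    unfolding compact_operators_def
    by (simp add: compact_eq_totally_bounded complete_eq_closed)
qed

section \<open>Uniform boundedness\<close>

text \<open>
  The closed sets \<open>A n\<close> of points where the family is bounded by \<open>n\<close> cover the space, so by Baire's
  theorem one of them contains a ball. Differences of points of this ball fill a ball around \<open>0\<close>, on
  which the family is bounded by \<open>2 n\<close>.
\<close>

lemma uniform_boundedness:
  fixes \<F> :: "('a::banach \<Rightarrow>\<^sub>L 'b::real_normed_vector) set"
  assumes pointwise: "\<And>x. \<exists>K. \<forall>f\<in>\<F>. norm (f x) \<le> K"
  shows "\<exists>C. \<forall>f\<in>\<F>. norm f \<le> C"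
proof -
  define A where "A n = {x. \<forall>f\<in>\<F>. norm (f x) \<le> real n}" for n :: nat
  have "closed (A n)" for n
  proof -
    have "A n = (\<Inter>f\<in>\<F>. {x. norm (blinfun_apply f x) \<le> real n})" by (auto simp: A_def)
    then show ?thesis
      by (auto intro!: closed_INT closed_Collect_le continuous_intros)
  qed
  moreover have "\<Union>(range A) = UNIV"
  proof (intro equalityI subsetI UNIV_I)
    fix x
    from pointwise obtain K where K: "\<forall>f\<in>\<F>. norm (f x) \<le> K" by blast
    obtain n where "K \<le> real n" using real_arch_simple by blast
    with K have "x \<in> A n" by (force simp: A_def)
    then show "x \<in> \<Union>(range A)" by blast
  qed
  ultimately have "\<exists>n. interior (A n) \<noteq> {}"
    using Met_TC.metric_Baire_category_alt[where ?'a = 'a and \<G> = "range A"]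
    by (auto simp: complete_UNIV)
  then obtain n x where "x \<in> interior (A n)" by blast
  then obtain r where r: "r > 0" "cball x r \<subseteq> A n" by (auto simp: mem_interior_cball)
  have "norm f \<le> 2 * real n / r" if f: "f \<in> \<F>" for f
  proof (rule norm_blinfun_bound)
    show "0 \<le> 2 * real n / r" using r by simp
    fix y
    show "norm (f y) \<le> 2 * real n / r * norm y"
    proof (cases "y = 0")
      case False
      let ?y = "(r / norm y) *\<^sub>R y"
      have "x + ?y \<in> A n" "x \<in> A n"
        by (rule subsetD[OF r(2)], use r(1) False in \<open>simp add: dist_norm\<close>)+
      with f have "norm (f (x + ?y)) \<le> real n" "norm (f x) \<le> real n" by (auto simp: A_def)
      then have "norm (f (x + ?y) - f x) \<le> 2 * real n"
        using norm_triangle_ineq4[of "f (x + ?y)" "f x"] by simp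
      then have "r / norm y * norm (f y) \<le> 2 * real n"
        using r by (simp add: blinfun.add_right blinfun.scaleR_right)
      then show ?thesis using r False by (simp add: field_simps)
    qed simp
  qed
  then show ?thesis by blast
qed

text \<open>
  A finite sum over \<open>F\<close> is the sum over \<open>F \<union> X\<close> minus that over \<open>X - F\<close>. For a suitable fixed \<open>X\<close> the
  first lies within \<open>1\<close> of the limit, and the second takes only finitely many values.
\<close>

lemma has_sum_bounded_finite_sums:
  fixes f :: "'i \<Rightarrow> 'a::real_normed_vector"
  assumes "(f has_sum l) UNIV"
  shows "\<exists>K. \<forall>F. finite F \<longrightarrow> norm (sum f F) \<le> K"
proof -
  from assms have "\<forall>\<^sub>F F in finite_subsets_at_top UNIV. dist (sum f F) l < 1"
    unfolding has_sum_def by (rule tendstoD) simp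
  then obtain X where X: "finite X" "\<And>Y. finite Y \<Longrightarrow> X \<subseteq> Y \<Longrightarrow> dist (sum f Y) l < 1"
    by (auto simp: eventually_finite_subsets_at_top)
  have "norm (sum f F) \<le> norm l + 1 + (\<Sum>i\<in>X. norm (f i))" if F: "finite F" for F
  proof -
    have "sum f (F \<union> X) = sum f F + sum f (X - F)"
      using F X(1) by (subst sum.union_disjoint[symmetric]) (auto intro: sum.cong)
    moreover have "norm (sum f (F \<union> X)) \<le> norm l + 1"
      using X(2)[of "F \<union> X"] F X(1) norm_triangle_ineq2[of "sum f (F \<union> X)" l]
      by (simp add: dist_norm)
    moreover have "norm (sum f (X - F)) \<le> (\<Sum>i\<in>X. norm (f i))"
      using X(1) by (intro order_trans[OF norm_sum] sum_mono2) auto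
    ultimately show ?thesis
      using norm_triangle_ineq4[of "sum f (F \<union> X)" "sum f (X - F)"] by simp
  qed
  then show ?thesis by blast
qed

section \<open>Bilinear forms as functionals on the projective tensor product\<close>

lemma bilinear_blinfun:
  fixes B :: "'a::real_normed_vector \<Rightarrow>\<^sub>L 'b::real_normed_vector \<Rightarrow>\<^sub>L real"
  shows "bilinear (\<lambda>x y. B x y)"
  by (auto simp: bilinear_def blinfun.bilinear_simps intro!: linearI)

text \<open>
  The choice of the representative made by \<^term>\<open>rep_tensor\<close> is immaterial, because equivalent formal
  sums agree under all bilinear forms.
\<close>

definition tensor_form ::
    "('a::real_normed_vector \<Rightarrow>\<^sub>L 'b::real_normed_vector \<Rightarrow>\<^sub>L real) \<Rightarrow> ('a, 'b) tensor \<Rightarrow> real"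
  where "tensor_form B u = form_sum (\<lambda>x y. B x y) (rep_tensor u)"

lemma tensor_form_tensor_of: "tensor_form B (tensor_of xs) = form_sum (\<lambda>x y. B x y) xs"
proof -
  have "tensor_eq (rep_tensor (tensor_of xs)) xs"
    by (rule rep_abs_rsp_left[OF Quotient3_tensor]) (simp add: tensor_eq_def)
  then show ?thesis
    by (simp add: tensor_form_def tensor_eq_def bilinear_blinfun)
qed

lemma tensor_form_add_right: "tensor_form B (u + v) = tensor_form B u + tensor_form B v"
proof -
  obtain xs ys where "tensor_of xs = u" "tensor_of ys = v" using tensor_of_surj by metis
  then show ?thesis by (auto simp: plus_tensor.abs_eq tensor_form_tensor_of)
qed

lemma tensor_form_scale_right: "tensor_form B (c *\<^sub>R u) = c * tensor_form B u"
proof -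
  obtain xs where "tensor_of xs = u" using tensor_of_surj by metis
  then show ?thesis
    by (auto simp: scaleR_tensor.abs_eq tensor_form_tensor_of form_sum_scale[OF bilinear_blinfun])
qed

lemma tensor_form_add_left: "tensor_form (B + C) u = tensor_form B u + tensor_form C u"
proof -
  have "form_sum (\<lambda>x y. (B + C) x y) xs = form_sum (\<lambda>x y. B x y) xs + form_sum (\<lambda>x y. C x y) xs" for xs
    by (induction xs) (auto simp: blinfun.add_left)
  then show ?thesis by (simp add: tensor_form_def)
qed

lemma tensor_form_scale_left: "tensor_form (c *\<^sub>R B) u = c * tensor_form B u"
proof -
  have "form_sum (\<lambda>x y. (c *\<^sub>R B) x y) xs = c * form_sum (\<lambda>x y. B x y) xs" for xs
    by (induction xs) (auto simp: blinfun.scaleR_left algebra_simps)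
  then show ?thesis by (simp add: tensor_form_def)
qed

lemma tensor_form_diff_right: "tensor_form B (u - v) = tensor_form B u - tensor_form B v"
  using tensor_form_add_right[of B "u - v" v] by simp

text \<open>
  The form is bounded by \<open>\<parallel>B\<parallel>\<close> times the cost of any representing formal sum, and the projective norm
  is the infimum of these costs.
\<close>

lemma tensor_form_bound: "\<bar>tensor_form B u\<bar> \<le> norm B * proj_norm u"
proof (rule field_le_epsilon)
  fix e :: real assume "e > 0"
  then have e: "e / (norm B + 1) > 0" by (simp add: add_nonneg_pos)
  obtain xs where xs: "tensor_of xs = u" "cost xs < proj_norm u + e / (norm B + 1)"
    by (rule proj_norm_approx[OF e])
  have "\<bar>B x y\<bar> \<le> norm B * (norm x * norm y)" for x y
    using norm_blinfun[of "B x" y] mult_right_mono[OF norm_blinfun[of B x] norm_ge_zero[of y]]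
    by (simp add: mult.assoc)
  then have "\<bar>form_sum (\<lambda>x y. B x y) xs\<bar> \<le> norm B * cost xs"
  proof (induction xs)
    case (Cons p xs)
    obtain x y where p: "p = (x, y)" by (cases p)
    have "\<bar>form_sum (\<lambda>x y. B x y) (p # xs)\<bar> \<le> \<bar>B x y\<bar> + \<bar>form_sum (\<lambda>x y. B x y) xs\<bar>"
      by (simp add: p)
    also have "\<dots> \<le> norm B * (norm x * norm y) + norm B * cost xs"
      using Cons by (intro add_mono) auto
    finally show ?case by (simp add: p cost_def distrib_left)
  qed (simp add: cost_def)
  then have "\<bar>tensor_form B u\<bar> \<le> norm B * cost xs"
    by (simp add: tensor_form_tensor_of flip: xs(1))
  also have "\<dots> \<le> norm B * (proj_norm u + e / (norm B + 1))"
    using xs(2) by (intro mult_left_mono) auto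
  also have "\<dots> = norm B * proj_norm u + e * (norm B / (norm B + 1))"
    by (simp add: algebra_simps)
  also have "\<dots> \<le> norm B * proj_norm u + e * 1"
    using \<open>e > 0\<close> by (intro add_left_mono mult_left_mono) (auto simp: divide_le_eq_1 add_nonneg_pos)
  finally show "\<bar>tensor_form B u\<bar> \<le> norm B * proj_norm u + e" by simp
qed

lemma tensor_form_LIMSEQ:
  assumes "proj_Cauchy f"
  shows "(\<lambda>n. tensor_form B (f n)) \<longlonglongrightarrow> lim (\<lambda>n. tensor_form B (f n))"
proof -
  have "Cauchy (\<lambda>n. tensor_form B (f n))"
  proof (rule CauchyI)
    fix e :: real assume "e > 0"
    then have "e / (norm B + 1) > 0" by (simp add: add_nonneg_pos)
    with assms obtain N where N: "\<And>m n. m \<ge> N \<Longrightarrow> n \<ge> N \<Longrightarrow> proj_norm (f m - f n) < e / (norm B + 1)"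
      unfolding proj_Cauchy_def by meson
    have "norm (tensor_form B (f m) - tensor_form B (f n)) < e" if "m \<ge> N" "n \<ge> N" for m n
    proof -
      have "\<bar>tensor_form B (f m) - tensor_form B (f n)\<bar> \<le> norm B * proj_norm (f m - f n)"
        using tensor_form_bound[of B "f m - f n"] by (simp add: tensor_form_diff_right)
      also have "\<dots> \<le> (norm B + 1) * proj_norm (f m - f n)"
        by (simp add: proj_norm_nonneg mult_right_mono)
      also have "\<dots> < e"
        using N[OF that] by (simp add: pos_less_divide_eq mult.commute add_nonneg_pos)
      finally show ?thesis by simp
    qed
    then show "\<exists>M. \<forall>m\<ge>M. \<forall>n\<ge>M. norm (tensor_form B (f m) - tensor_form B (f n)) < e" by blast
  qed
  then show ?thesis by (simp add: Cauchy_convergent_iff convergent_LIMSEQ_iff)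
qed

text \<open>
  The extension of \<^term>\<open>tensor_form B\<close> to the completion. It does not depend on the Cauchy sequence
  that represents a tensor, because the form is continuous for the projective norm.
\<close>

lift_definition proj_form ::
    "('a::real_normed_vector \<Rightarrow>\<^sub>L 'b::real_normed_vector \<Rightarrow>\<^sub>L real) \<Rightarrow> ('a, 'b) proj_tensor \<Rightarrow> real"
  is "\<lambda>B f. lim (\<lambda>n. tensor_form B (f n))"
  subgoal premises fg for B f g
  proof -
  have "(\<lambda>n. norm B * proj_norm (f n - g n)) \<longlonglongrightarrow> 0"
    using fg by (auto simp: completion_eq_def intro: tendsto_mult_right_zero)
  then have "(\<lambda>n. tensor_form B (f n) - tensor_form B (g n)) \<longlonglongrightarrow> 0"
    by (rule Lim_null_comparison[rotated])
       (simp add: tensor_form_bound flip: tensor_form_diff_right)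
  from tendsto_diff[OF tensor_form_LIMSEQ this, of f B] fg
  show ?thesis
    by (simp add: completion_eq_def limI)
  qed
  done

lemma proj_form_add_right: "proj_form B (z + w) = proj_form B z + proj_form B w"
  by transfer (simp add: completion_eq_def tensor_form_add_right limI
      tendsto_add[OF tensor_form_LIMSEQ tensor_form_LIMSEQ])

lemma proj_form_scale_right: "proj_form B (c *\<^sub>R z) = c * proj_form B z"
  by transfer (simp add: completion_eq_def tensor_form_scale_right limI
      tendsto_mult_left[OF tensor_form_LIMSEQ])

lemma proj_form_add_left: "proj_form (B + C) z = proj_form B z + proj_form C z"
  by transfer (simp add: completion_eq_def tensor_form_add_left limI
      tendsto_add[OF tensor_form_LIMSEQ tensor_form_LIMSEQ])

lemma proj_form_scale_left: "proj_form (c *\<^sub>R B) z = c * proj_form B z"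
  by transfer (simp add: completion_eq_def tensor_form_scale_left limI
      tendsto_mult_left[OF tensor_form_LIMSEQ])

lemma proj_form_bound:
  fixes B :: "'a::real_normed_vector \<Rightarrow>\<^sub>L 'b::real_normed_vector \<Rightarrow>\<^sub>L real"
  shows "\<bar>proj_form B z\<bar> \<le> norm B * norm z"
proof (transfer fixing: B)
  fix f :: "nat \<Rightarrow> ('a, 'b) tensor"
  assume f: "completion_eq f f"
  then have "(\<lambda>n. proj_norm (f n)) \<longlonglongrightarrow> lim (\<lambda>n. proj_norm (f n))"
    using proj_norm_convergent by (simp add: completion_eq_def convergent_LIMSEQ_iff)
  then have "(\<lambda>n. norm B * proj_norm (f n)) \<longlonglongrightarrow> norm B * lim (\<lambda>n. proj_norm (f n))"
    by (rule tendsto_mult_left)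
  moreover have "(\<lambda>n. \<bar>tensor_form B (f n)\<bar>) \<longlonglongrightarrow> \<bar>lim (\<lambda>n. tensor_form B (f n))\<bar>"
    using f by (intro tendsto_rabs tensor_form_LIMSEQ) (simp add: completion_eq_def)
  ultimately show "\<bar>lim (\<lambda>n. tensor_form B (f n))\<bar> \<le> norm B * lim (\<lambda>n. proj_norm (f n))"
    using tensor_form_bound by (intro LIMSEQ_le) auto
qed

lemma bounded_linear_proj_form: "bounded_linear (proj_form B)"
  by (rule bounded_linear_intro[where K = "norm B"])
     (use proj_form_bound[of B] in \<open>auto simp: proj_form_add_right proj_form_scale_right mult.commute\<close>)

lemma linear_proj_form_left: "linear (\<lambda>B. proj_form B z)"
  by (rule linearI) (simp_all add: proj_form_add_left proj_form_scale_left)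

lemma proj_form_elementary: "proj_form B (proj_embed (tensor_of [(x, y)])) = B x y"
proof -
  have "proj_form B (proj_embed u) = tensor_form B u" for u
    by transfer (simp add: limI)
  then show ?thesis by (simp add: tensor_form_tensor_of)
qed

text \<open>
  Elementary tensors already detect the norm of \<open>B\<close>: choose \<open>x\<close> with \<open>B x\<close> large, then \<open>y\<close> with \<open>B x y\<close>
  large, and rescale \<open>x \<otimes> y\<close>.
\<close>

lemma proj_form_norming:
  assumes "0 < d" "d < norm B"
  obtains w where "proj_form B w = 1" "norm w \<le> 1 / d"
proof -
  obtain x where x: "d * norm x < norm (B x)"
    using norm_blinfun_bound[of d B] assms by (meson less_le_not_le not_le)
  obtain y where y: "d * norm x * norm y < norm (B x y)"
    using norm_blinfun_bound[of "d * norm x" "B x"] assms x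
    by (meson less_le_not_le not_le mult_nonneg_nonneg norm_ge_zero)
  define u where "u = proj_embed (tensor_of [(x, y)])"
  have "norm u \<le> norm x * norm y"
    unfolding u_def norm_proj_embed using proj_norm_le[of "[(x, y)]"] by (simp add: cost_def)
  then have "d * norm u \<le> d * (norm x * norm y)"
    using assms by (intro mult_left_mono) auto
  with y have u: "d * norm u < \<bar>B x y\<bar>" by (simp add: mult.assoc)
  have pos: "0 < \<bar>B x y\<bar>"
    by (rule le_less_trans[OF _ u]) (use assms in simp)
  show thesis
  proof (rule that[of "(1 / B x y) *\<^sub>R u"])
    show "proj_form B ((1 / B x y) *\<^sub>R u) = 1"
      using pos by (simp add: proj_form_scale_right proj_form_elementary u_def)
    show "norm ((1 / B x y) *\<^sub>R u) \<le> 1 / d"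
      using pos u assms by (simp add: field_simps)
  qed
qed

section \<open>Unconditional sums of finite-rank operators\<close>

text \<open>
  The blocks are chosen one after the other, each beyond all elements of the previous ones.
\<close>

lemma disjoint_blocks:
  assumes "\<And>N. \<exists>F::nat set. finite F \<and> F \<subseteq> {N..} \<and> P F"
  obtains G :: "nat \<Rightarrow> nat set" where "\<And>k. finite (G k)" "\<And>k. P (G k)"
    "\<And>i j. i \<noteq> j \<Longrightarrow> G i \<inter> G j = {}"
proof -
  let ?Q = "\<lambda>(f :: nat \<Rightarrow> nat set) k F. finite F \<and> P F \<and> (\<forall>j<k. f j \<inter> F = {})"
  have "\<exists>G. \<forall>k. ?Q G k (G k)"
  proof (rule dependent_wellorder_choice[where P = ?Q])
    fix k :: nat and f assume "\<And>j. j < k \<Longrightarrow> ?Q f j (f j)"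
    then have "finite (\<Union>j<k. f j)" by auto
    then obtain N where N: "\<forall>n\<in>(\<Union>j<k. f j). n < N" by (metis finite_nat_set_iff_bounded)
    obtain F where "finite F" "F \<subseteq> {N..}" "P F" using assms by blast
    with N show "\<exists>F. ?Q f k F" by (intro exI[of _ F]) fastforce
  qed auto
  then obtain G where G: "\<And>k. ?Q G k (G k)" by blast
  then have "G i \<inter> G j = {}" if "i \<noteq> j" for i j
    using that by (metis Int_commute linorder_neqE_nat)
  with G show thesis by (intro that[of G]) auto
qed

text \<open>
  If all blocks far out were small, the tails \<open>T - \<Sum>\<^bsub>n < N\<^esub> U\<^sub>n\<close>, as pointwise limits of sums over
  blocks, would be small in operator norm, and \<open>T\<close> would be a norm limit of finite-rank operators.
\<close>

lemma large_blocks_of_noncompact_sum: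
  fixes U :: "nat \<Rightarrow> 'a::real_normed_vector \<Rightarrow>\<^sub>L 'b::banach" and T :: "'a \<Rightarrow>\<^sub>L 'b"
  assumes sum: "\<And>x. ((\<lambda>n. U n x) has_sum T x) UNIV"
    and fin: "\<And>n. finite_rank (U n)" and nc: "T \<notin> compact_operators"
  obtains d where "d > 0" "\<And>N. \<exists>F. finite F \<and> F \<subseteq> {N..} \<and> d < norm (sum U F)"
proof -
  have "\<exists>d>0. \<forall>N. \<exists>F. finite F \<and> F \<subseteq> {N..} \<and> d < norm (sum U F)"
  proof (rule ccontr)
    assume "\<not> ?thesis"
    then have cauchy: "\<exists>N. \<forall>F. finite F \<and> F \<subseteq> {N..} \<longrightarrow> norm (sum U F) \<le> d" if "d > 0" for d
      using that by (meson not_less)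
    have "T \<in> compact_operators"
    proof (rule compact_operatorI_approx)
      fix e :: real assume e: "e > 0"
      from cauchy[OF this] obtain N
        where N: "\<And>F. finite F \<Longrightarrow> F \<subseteq> {N..} \<Longrightarrow> norm (sum U F) \<le> e" by blast
      have "norm (T - sum U {..<N}) \<le> e"
      proof (rule norm_blinfun_bound)
        fix x
        have "(\<lambda>m. sum U {..<m} x - sum U {..<N} x) \<longlonglongrightarrow> T x - sum U {..<N} x"
          using has_sum_imp_sums[OF sum[of x]]
          by (intro tendsto_diff tendsto_const) (simp add: sums_def blinfun.sum_left)
        then have "norm (T x - sum U {..<N} x) \<le> e * norm x"
        proof (rule LIMSEQ_le_const2[OF tendsto_norm], intro exI allI impI)
          fix m assume "N \<le> m"
          then have "sum U {..<m} - sum U {..<N} = sum U {N..<m}"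
            by (metis lessThan_atLeast0 sum_diff_nat_ivl zero_le)
          then have "norm (sum U {..<m} x - sum U {..<N} x) = norm (sum U {N..<m} x)"
            by (simp flip: blinfun.diff_left)
          also have "\<dots> \<le> norm (sum U {N..<m}) * norm x" by (rule norm_blinfun)
          also have "\<dots> \<le> e * norm x" by (intro mult_right_mono N) auto
          finally show "norm (sum U {..<m} x - sum U {..<N} x) \<le> e * norm x" .
        qed
        then show "norm ((T - sum U {..<N}) x) \<le> e * norm x" by (simp add: blinfun.diff_left)
      qed (use e in simp)
      moreover obtain S where "finite S" "range (sum U {..<N}) \<subseteq> span S"
        by (rule range_sum_finite_rank[of U "{..<N}", OF fin finite_lessThan])
      ultimately show "\<exists>V S. finite S \<and> range (blinfun_apply V) \<subseteq> span S \<and> norm (T - V) \<le> e"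
        by (intro exI[of _ "sum U {..<N}"] exI[of _ S]) simp
    qed
    with nc show False by blast
  qed
  with that show thesis by blast
qed

text \<open>
  The functionals given by large disjoint blocks satisfy the hypotheses of
  \<open>complemented_l1_of_wuc_functionals\<close>. Pointwise unconditional convergence enters through the uniform
  bound on all finite sums, which absorbs arbitrary unions of blocks.
\<close>

lemma complemented_l1_of_noncompact_sum:
  fixes U :: "nat \<Rightarrow> 'x::banach \<Rightarrow>\<^sub>L 'y::real_normed_vector \<Rightarrow>\<^sub>L real"
    and T :: "'x \<Rightarrow>\<^sub>L 'y \<Rightarrow>\<^sub>L real"
  assumes sum: "\<And>x. ((\<lambda>n. U n x) has_sum T x) UNIV"
    and fin: "\<And>n. finite_rank (U n)" and nc: "T \<notin> compact_operators"
  shows "contains_complemented_l1 TYPE(('x, 'y) proj_tensor)"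
proof -
  have "\<exists>C. \<forall>V\<in>{sum U F | F. finite F}. norm V \<le> C"
  proof (rule uniform_boundedness)
    fix x
    obtain K where "\<And>F. finite F \<Longrightarrow> norm (\<Sum>n\<in>F. U n x) \<le> K"
      using has_sum_bounded_finite_sums[OF sum[of x]] by blast
    then have "norm (sum U F x) \<le> K" if "finite F" for F
      using that by (simp add: blinfun.sum_left)
    then show "\<exists>K. \<forall>V\<in>{sum U F | F. finite F}. norm (V x) \<le> K" by blast
  qed
  then obtain C where C: "\<And>F. finite F \<Longrightarrow> norm (sum U F) \<le> C" by blast
  obtain d where d: "d > 0" "\<And>N. \<exists>F. finite F \<and> F \<subseteq> {N..} \<and> d < norm (sum U F)"
    using large_blocks_of_noncompact_sum[OF sum fin nc] by metis
  obtain G :: "nat \<Rightarrow> nat set" where G: "\<And>k. finite (G k)" "\<And>k. d < norm (sum U (G k))"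
    "\<And>i j. i \<noteq> j \<Longrightarrow> G i \<inter> G j = {}"
    using disjoint_blocks[of "\<lambda>F. d < norm (sum U F)", OF d(2)] by metis
  define \<phi> where "\<phi> k = Blinfun (proj_form (sum U (G k)))" for k
  have \<phi>: "\<phi> k z = proj_form (sum U (G k)) z" for k z
    by (simp add: \<phi>_def bounded_linear_Blinfun_apply[OF bounded_linear_proj_form])
  \<comment> \<open>A sum of disjoint blocks is again a finite sum of the \<open>U n\<close>, so the bound \<open>C\<close> applies.\<close>
  have same_sign: "\<bar>\<Sum>k\<in>F. \<phi> k z\<bar> \<le> C * norm z" if F: "finite F" for F z
  proof -
    have "(\<Sum>k\<in>F. \<phi> k z) = proj_form (\<Sum>k\<in>F. sum U (G k)) z"
      by (simp add: \<phi> linear_sum[OF linear_proj_form_left])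
    also have "(\<Sum>k\<in>F. sum U (G k)) = sum U (\<Union>k\<in>F. G k)"
      using F G(1,3) by (intro sum.UNION_disjoint[symmetric]) auto
    also have "\<bar>proj_form (sum U (\<Union>k\<in>F. G k)) z\<bar> \<le> norm (sum U (\<Union>k\<in>F. G k)) * norm z"
      by (rule proj_form_bound)
    also have "\<dots> \<le> C * norm z"
      using F G(1) by (intro mult_right_mono C) auto
    finally show ?thesis .
  qed
  \<comment> \<open>Splitting \<open>F\<close> by the sign of \<open>\<phi> k z\<close> turns bounds for sums into bounds for sums of absolute values.\<close>
  have wuc: "(\<Sum>k\<in>F. \<bar>\<phi> k z\<bar>) \<le> 2 * C * norm z" if F: "finite F" for F z
  proof -
    have "(\<Sum>k\<in>F. \<bar>\<phi> k z\<bar>)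
        = (\<Sum>k\<in>{k \<in> F. 0 \<le> \<phi> k z}. \<bar>\<phi> k z\<bar>) + (\<Sum>k\<in>{k \<in> F. \<not> 0 \<le> \<phi> k z}. \<bar>\<phi> k z\<bar>)"
      using F by (subst sum.union_disjoint[symmetric]) (auto intro: sum.cong)
    also have "\<dots> = (\<Sum>k\<in>{k \<in> F. 0 \<le> \<phi> k z}. \<phi> k z) - (\<Sum>k\<in>{k \<in> F. \<not> 0 \<le> \<phi> k z}. \<phi> k z)"
      by (simp add: sum_negf[symmetric])
    also have "\<dots> \<le> C * norm z + C * norm z"
    proof -
      have "finite {k \<in> F. 0 \<le> \<phi> k z}" "finite {k \<in> F. \<not> 0 \<le> \<phi> k z}"
        using F by auto
      from same_sign[OF this(1), of z] same_sign[OF this(2), of z] show ?thesis by linarith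
    qed
    also have "\<dots> = 2 * C * norm z" by simp
    finally show ?thesis .
  qed
  have "\<exists>w. proj_form (sum U (G k)) w = 1 \<and> norm w \<le> 1 / d" for k
    using proj_form_norming[OF d(1) G(2)[of k]] by metis
  then obtain w where w: "\<And>k. proj_form (sum U (G k)) (w k) = 1" "\<And>k. norm (w k) \<le> 1 / d"
    by metis
  show ?thesis
    using complemented_l1_of_wuc_functionals[of \<phi> "2 * C" w "1 / d"] wuc w by (simp add: \<phi>)
qed

section \<open>Compactness of all operators from \<open>X\<close> to \<open>Y\<^sup>*\<close>\<close>

lemma finite_rank_compose_left:
  fixes P :: "'a::real_normed_vector \<Rightarrow>\<^sub>L 'b::real_normed_vector"
    and T :: "'b \<Rightarrow>\<^sub>L 'c::real_normed_vector"
  assumes "finite_rank P"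
  shows "finite_rank (T o\<^sub>L P)"
proof -
  from assms obtain S where "finite S" "range P = span S" unfolding finite_rank_def by blast
  moreover have "range (T o\<^sub>L P) = T ` range P" by auto
  ultimately show ?thesis
    unfolding finite_rank_def
    using linear_span_image[OF bounded_linear.linear[OF blinfun.bounded_linear_right], of T S]
    by (intro exI[of _ "T ` S"]) auto
qed

text \<open>
  The range of \<open>P \<circ> T\<close> is only a subspace of that of \<open>P\<close>; a basis of it is finite because it is an
  independent set in the span of a finite set.
\<close>

lemma finite_rank_compose_right:
  fixes P :: "'b::real_normed_vector \<Rightarrow>\<^sub>L 'c::real_normed_vector"
    and T :: "'a::real_normed_vector \<Rightarrow>\<^sub>L 'b"
  assumes "finite_rank P"
  shows "finite_rank (P o\<^sub>L T)"
proof -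
  from assms obtain S where S: "finite S" "range P = span S" unfolding finite_rank_def by blast
  have "subspace (range (P o\<^sub>L T))"
    by (intro linear_subspace_image subspace_UNIV bounded_linear.linear blinfun.bounded_linear_right)
  obtain B where B: "B \<subseteq> range (P o\<^sub>L T)" "independent B" "range (P o\<^sub>L T) \<subseteq> span B"
    using maximal_independent_subset by blast
  have "B \<subseteq> span S" using B(1) S(2) by auto
  then have "finite B" using independent_span_bound[OF S(1) B(2)] by blast
  moreover have "range (P o\<^sub>L T) = span B"
    using B(1,3) \<open>subspace _\<close> span_minimal by blast
  ultimately show ?thesis unfolding finite_rank_def by blast
qed

theorem theorem4p6:
  assumes "has_unconditional_fd_expansion TYPE('x::banach) \<or>
           has_unconditional_fd_expansion TYPE('y::banach \<Rightarrow>\<^sub>L real)"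
    and "\<not> contains_complemented_l1 TYPE(('x, 'y) proj_tensor)"
  shows "(UNIV :: ('x \<Rightarrow>\<^sub>L ('y \<Rightarrow>\<^sub>L real)) set) = compact_operators"
proof (rule ccontr)
  assume "\<not> ?thesis"
  then obtain T :: "'x \<Rightarrow>\<^sub>L ('y \<Rightarrow>\<^sub>L real)" where nc: "T \<notin> compact_operators" by blast
  from assms(1) have "contains_complemented_l1 TYPE(('x, 'y) proj_tensor)"
  proof
    assume "has_unconditional_fd_expansion TYPE('x)"
    then obtain P :: "nat \<Rightarrow> 'x \<Rightarrow>\<^sub>L 'x"
      where P: "\<And>z. ((\<lambda>n. P n z) has_sum z) UNIV" "\<And>n. finite_rank (P n)"
      unfolding has_unconditional_fd_expansion_def unconditional_expansion_def by blast
    have "((\<lambda>n. (T o\<^sub>L P n) x) has_sum T x) UNIV" for x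
      using has_sum_bounded_linear[OF blinfun.bounded_linear_right[of T] P(1)[of x]]
      by (simp add: o_def)
    then show ?thesis
      by (rule complemented_l1_of_noncompact_sum[OF _ finite_rank_compose_left[OF P(2)] nc])
  next
    assume "has_unconditional_fd_expansion TYPE('y \<Rightarrow>\<^sub>L real)"
    then obtain P :: "nat \<Rightarrow> ('y \<Rightarrow>\<^sub>L real) \<Rightarrow>\<^sub>L ('y \<Rightarrow>\<^sub>L real)"
      where P: "\<And>z. ((\<lambda>n. P n z) has_sum z) UNIV" "\<And>n. finite_rank (P n)"
      unfolding has_unconditional_fd_expansion_def unconditional_expansion_def by blast
    have "((\<lambda>n. (P n o\<^sub>L T) x) has_sum T x) UNIV" for x
      using P(1)[of "T x"] by simp
    then show ?thesis
      by (rule complemented_l1_of_noncompact_sum[OF _ finite_rank_compose_right[OF P(2)] nc])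
  qed
  with assms(2) show False by blast
qed

end
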